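(* Every ($P_5$, house, bull)-free graph is recolorable.
   Context: Graphs are finite and simple. $P_5$ is the path on 5 vertices; the house is the complement of $P_5$ (a 5-cycle with one chord); the bull is a triangle $xyz$ together with two further vertices $u,w$ where $u$ is adjacent only to $x$ and $w$ only to $y$. A graph is $\mathcal{H}$-free if it has no induced subgraph isomorphic to a member of $\mathcal{H}$. A $k$-coloring of $G$ is a map $V(G)\to\{1,\dots,k\}$ giving adjacent vertices different colors; $\chi(G)$ is the chromatic number. $R_k(G)$ is the graph whose vertices are the $k$-colorings of $G$, two adjacent if they differ on exactly one vertex. $G$ is recolorable if $R_\ell(G)$ is connected for every $\ell\ge\chi(G)+1$. *)

theory Defs
  imports "HOL-Library.FuncSet" "Graph_Theory.Graph_Theory"
begin

text \<open>
  A finite simple graph is a \<^locale>\<open>pair_graph\<close>: a finite, loop-free, symmetric digraph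
  without parallel arcs, each edge being represented by its two opposite arcs.
\<close>

definition complement_graph :: "'a pair_pre_digraph \<Rightarrow> 'a pair_pre_digraph" where
  "complement_graph G =
    \<lparr> pverts = pverts G,
      parcs = {(u, v). u \<in> pverts G \<and> v \<in> pverts G \<and> u \<noteq> v \<and> (u, v) \<notin> parcs G} \<rparr>"

definition path_graph :: "nat \<Rightarrow> nat pair_pre_digraph" where
  "path_graph n =
    \<lparr> pverts = {..<n},
      parcs = {(i, j). i < n \<and> j < n \<and> (j = Suc i \<or> i = Suc j)} \<rparr>"

abbreviation P5 :: "nat pair_pre_digraph" where
  "P5 \<equiv> path_graph 5"

definition house :: "nat pair_pre_digraph" where
  "house = complement_graph P5"

text \<open>Triangle 0, 1, 2 with a pendant vertex 3 at 0 and a pendant vertex 4 at 1.\<close>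

definition bull :: "nat pair_pre_digraph" where
  "bull =
    (let E = {(0, 1), (0, 2), (1, 2), (3, 0), (4, 1)}
     in \<lparr> pverts = {..<5}, parcs = E \<union> E\<inverse> \<rparr>)"

definition induced_free :: "'b pair_pre_digraph set \<Rightarrow> 'a pair_pre_digraph \<Rightarrow> bool" where
  "induced_free \<F> G \<longleftrightarrow>
    \<not> (\<exists>F\<in>\<F>. \<exists>H. induced_subgraph H (with_proj G) \<and> digraph_iso H (with_proj F))"

text \<open>
  Colorings are extensional functions, so that two colorings are equal exactly when they agree
  on the vertices of the graph.
\<close>

definition colorings :: "'a pair_pre_digraph \<Rightarrow> nat \<Rightarrow> ('a \<Rightarrow> nat) set" where
  "colorings G k =
    {c \<in> pverts G \<rightarrow>\<^sub>E {1..k}. \<forall>(u, v) \<in> parcs G. c u \<noteq> c v}"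

definition chromatic_number :: "'a pair_pre_digraph \<Rightarrow> nat" where
  "chromatic_number G = (LEAST k. colorings G k \<noteq> {})"

definition recoloring_graph :: "nat \<Rightarrow> 'a pair_pre_digraph \<Rightarrow> ('a \<Rightarrow> nat) pair_pre_digraph" where
  "recoloring_graph k G =
    \<lparr> pverts = colorings G k,
      parcs = {(c, d). c \<in> colorings G k \<and> d \<in> colorings G k \<and>
                       (\<exists>!v. v \<in> pverts G \<and> c v \<noteq> d v)} \<rparr>"

definition recolorable :: "'a pair_pre_digraph \<Rightarrow> bool" where
  "recolorable G \<longleftrightarrow>
    (\<forall>l \<ge> chromatic_number G + 1. connected (with_proj (recoloring_graph l G)))"

end

theory Submission
  imports Defs
begin

text \<open>
  Consider a counterexample with as few vertices as possible. It has no simplicial vertex, because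
  such a vertex always has a spare color and can step aside while the rest is recolored. Its proper
  modules are cliques, because a module \<open>M\<close> can be replaced by a clique of size \<open>\<chi>(M)\<close> without
  leaving the class. If it contains an induced 5-cycle, every further vertex is a twin of a cycle
  vertex, or adjacent to all, or to none of them; the twins form a module that is not a clique, so
  the graph is a clique blow-up of the 5-cycle, and such a blow-up is recolorable because a color
  class of an optimal coloring can be split off. If it contains no induced 5-cycle, a maximality argument produces a
  simplicial vertex after all.
\<close>

text \<open>Recolorability of the smaller graphs alone would not carry the induction: deleting
  vertices may lower the chromatic number, and a part of the graph is often recolored inside a
  palette left free by the rest. Hence palettes are arbitrary finite sets, and \<open>n\<close> is
  any number of colors that suffices. Replacing a module by a clique changes the adjacency itself,
  so graphs are pairs of a set and a relation.

  Clique modules are exempt because a clique needs as many colors as it has vertices, so nothing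
  shrinks; in any other module two nonadjacent vertices can share a color, and the replacing clique
  is smaller.

  A clique blow-up of the 5-cycle has no simplicial vertex, as every vertex has neighbors in two
  mutually nonadjacent parts. The obstacle there is that the color class to be split off need not be
  a class of the given coloring; a suitable pair must be made monochromatic by explicit
  moves.\<close>

definition proper_col :: "'a set \<Rightarrow> ('a \<Rightarrow> 'a \<Rightarrow> bool) \<Rightarrow> nat set \<Rightarrow> ('a \<Rightarrow> nat) \<Rightarrow> bool" where
  "proper_col V E L c \<longleftrightarrow> (\<forall>v\<in>V. c v \<in> L) \<and> (\<forall>u\<in>V. \<forall>v\<in>V. E u v \<longrightarrow> c u \<noteq> c v)"

text \<open>Values of colorings outside \<open>V\<close> are irrelevant: colorings agreeing on \<open>V\<close> are one step apart.\<close>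

definition recol :: "'a set \<Rightarrow> ('a \<Rightarrow> 'a \<Rightarrow> bool) \<Rightarrow> nat set \<Rightarrow> ('a \<Rightarrow> nat) \<Rightarrow> ('a \<Rightarrow> nat) \<Rightarrow> bool" where
  "recol V E L c d \<longleftrightarrow>
    proper_col V E L c \<and> proper_col V E L d \<and> (\<exists>v. \<forall>u\<in>V - {v}. c u = d u)"

abbreviation linked :: "'a set \<Rightarrow> ('a \<Rightarrow> 'a \<Rightarrow> bool) \<Rightarrow> nat set \<Rightarrow> ('a \<Rightarrow> nat) \<Rightarrow> ('a \<Rightarrow> nat) \<Rightarrow> bool" where
  "linked V E L \<equiv> (recol V E L)\<^sup>*\<^sup>*"

definition mixing :: "'a set \<Rightarrow> ('a \<Rightarrow> 'a \<Rightarrow> bool) \<Rightarrow> nat set \<Rightarrow> bool" where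
  "mixing V E L \<longleftrightarrow> (\<forall>c d. proper_col V E L c \<longrightarrow> proper_col V E L d \<longrightarrow> linked V E L c d)"

definition colorable :: "'a set \<Rightarrow> ('a \<Rightarrow> 'a \<Rightarrow> bool) \<Rightarrow> nat \<Rightarrow> bool" where
  "colorable V E n \<longleftrightarrow> (\<exists>c. proper_col V E {..<n} c)"

text \<open>
  This is recolorability without the chromatic number: the palette is an arbitrary finite set with
  more than \<open>n\<close> elements, for some \<open>n\<close> that suffices to color \<open>V\<close>.
\<close>

definition always_mixing :: "'a set \<Rightarrow> ('a \<Rightarrow> 'a \<Rightarrow> bool) \<Rightarrow> bool" where
  "always_mixing V E \<longleftrightarrow>
    (\<forall>L n. finite L \<longrightarrow> n < card L \<longrightarrow> colorable V E n \<longrightarrow> mixing V E L)"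

definition clique :: "'a set \<Rightarrow> ('a \<Rightarrow> 'a \<Rightarrow> bool) \<Rightarrow> bool" where
  "clique K E \<longleftrightarrow> (\<forall>x\<in>K. \<forall>y\<in>K. x \<noteq> y \<longrightarrow> E x y)"

definition is_module :: "'a set \<Rightarrow> ('a \<Rightarrow> 'a \<Rightarrow> bool) \<Rightarrow> 'a set \<Rightarrow> bool" where
  "is_module V E M \<longleftrightarrow> M \<subseteq> V \<and> (\<forall>z\<in>V - M. \<forall>x\<in>M. \<forall>y\<in>M. E z x \<longleftrightarrow> E z y)"

subsection \<open>Recoloring sequences\<close>

lemma proper_col_mono:
  assumes "proper_col V E L c" "W \<subseteq> V" "L \<subseteq> L'" shows "proper_col W E L' c"
  using assms unfolding proper_col_def by blast

lemma proper_col_cong: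
  assumes "\<And>v. v \<in> V \<Longrightarrow> c v = d v" shows "proper_col V E L c \<longleftrightarrow> proper_col V E L d"
  using assms unfolding proper_col_def by auto

lemma proper_col_image: "proper_col V E L c \<Longrightarrow> proper_col V E (c ` V) c"
  unfolding proper_col_def by auto

lemma always_mixingD:
  assumes "always_mixing V E" "finite L" "n < card L" "colorable V E n"
    "proper_col V E L c" "proper_col V E L d"
  shows "linked V E L c d"
  using assms unfolding always_mixing_def mixing_def by blast

lemma linked_sym: "linked V E L c d \<Longrightarrow> linked V E L d c"
proof (induction rule: rtranclp_induct)
  case (step d e)
  then have "recol V E L e d" unfolding recol_def by metis
  then show ?case using step.IH by (meson converse_rtranclp_into_rtranclp)
qed simp

lemma linked_proper: "linked V E L c d \<Longrightarrow> proper_col V E L c \<Longrightarrow> proper_col V E L d"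
  by (induction rule: rtranclp_induct) (auto simp: recol_def)

lemma linked_single:
  assumes "proper_col V E L c" "proper_col V E L d" "\<And>u. u \<in> V \<Longrightarrow> u \<noteq> v \<Longrightarrow> c u = d u"
  shows "linked V E L c d"
  using assms unfolding recol_def by (intro r_into_rtranclp) blast

lemma linked_eq:
  assumes "proper_col V E L c" "\<And>u. u \<in> V \<Longrightarrow> c u = d u"
  shows "linked V E L c d"
  using assms proper_col_cong[of V c d E L] by (intro linked_single) auto

text \<open>The vertices of \<open>I\<close> receive their final colors one at a time. All neighbors
  of such a vertex lie outside \<open>I\<close>, where \<open>c\<close> and \<open>d\<close> already
  agree, so every intermediate coloring is proper.\<close>

lemma linked_if_differ_on_independent:
  assumes "finite I" "proper_col V E L c" "proper_col V E L d" "\<And>u v. u \<in> I \<Longrightarrow> v \<in> I \<Longrightarrow> \<not> E u v"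
    and "\<And>u. u \<in> V \<Longrightarrow> u \<notin> I \<Longrightarrow> c u = d u"
  shows "linked V E L c d"
  using assms
proof (induction I arbitrary: c rule: finite_induct)
  case empty
  then show ?case by (auto intro: linked_eq)
next
  case (insert x I)
  let ?c = "c(x := d x)"
  have p: "proper_col V E L ?c"
    using insert.prems unfolding proper_col_def by (auto; metis insertCI)
  have "linked V E L c ?c"
    using insert.prems p by (intro linked_single[where v = x]) auto
  also have "linked V E L ?c d"
    by (rule insert.IH[OF p]) (use insert.prems in auto)
  finally show ?case .
qed

text \<open>As long as \<open>W\<close> keeps to the palette \<open>A\<close>, no conflict can arise
  with the fixed coloring \<open>b\<close>, since vertices outside with a neighbor in
  \<open>W\<close> avoid \<open>A\<close>. Other outside vertices may use colors of
  \<open>A\<close>.\<close>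

lemma linked_override:
  assumes W: "W \<subseteq> V" and A: "A \<subseteq> L" and sym: "symp E"
    and b: "proper_col (V - W) E L b"
    and sep: "\<And>z w. z \<in> V - W \<Longrightarrow> w \<in> W \<Longrightarrow> E z w \<Longrightarrow> b z \<notin> A"
    and lk: "linked W E A c d"
  shows "linked V E L (override_on b c W) (override_on b d W)"
proof -
  have p: "proper_col V E L (override_on b c W)" if "proper_col W E A c" for c
    unfolding proper_col_def
  proof (intro conjI ballI impI)
    fix v assume "v \<in> V"
    then show "override_on b c W v \<in> L"
      using that b A by (cases "v \<in> W") (auto simp: proper_col_def)
  next
    fix u v assume uv: "u \<in> V" "v \<in> V" "E u v"
    then have "E v u" using sym by (auto dest: sympD)
    then show "override_on b c W u \<noteq> override_on b c W v"
      using that b uv sep[of u v] sep[of v u] unfolding proper_col_def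
      by (cases "u \<in> W"; cases "v \<in> W") auto
  qed
  show ?thesis using lk
  proof (induction rule: rtranclp_induct)
    case (step d e)
    then have "recol V E L (override_on b d W) (override_on b e W)"
      unfolding recol_def using p by (auto simp: override_on_def)
    then show ?case using step.IH by simp
  qed simp
qed

subsection \<open>Colorability\<close>

lemma ex_not_in_if_card_less:
  assumes "finite A" "card A < card B" obtains x where "x \<in> B" "x \<notin> A"
  using assms card_mono[of A B] by (meson linorder_not_less subsetI)

lemma proper_col_compose:
  assumes "proper_col V E L c" "inj_on f L" "f ` L \<subseteq> L'"
  shows "proper_col V E L' (f \<circ> c)"
  using assms unfolding proper_col_def inj_on_def by (auto; blast)

lemma colorable_card:
  assumes "proper_col V E L c" "finite L" "card L \<le> n"
  shows "colorable V E n"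
proof -
  obtain f where "inj_on f L" "f ` L \<subseteq> {..<n}"
    using card_le_inj[of L "{..<n}"] assms by auto
  then show ?thesis using proper_col_compose[OF assms(1)] unfolding colorable_def by blast
qed

lemma colorable_obtain:
  assumes "colorable V E n" "finite L" "n \<le> card L"
  obtains P c where "P \<subseteq> L" "finite P" "card P = n" "proper_col V E P c"
proof -
  obtain P where P: "P \<subseteq> L" "card P = n" "finite P"
    using obtain_subset_with_card_n[OF assms(3)] by metis
  obtain f where "bij_betw f {..<n} P" using P by (metis card_lessThan finite_lessThan bij_betw_iff_card)
  then show ?thesis using assms(1) P that proper_col_compose unfolding colorable_def bij_betw_def
    by (metis order_refl)
qed

lemma colorable_mono:
  assumes "colorable V E n" "W \<subseteq> V" "n \<le> m" shows "colorable W E m"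
  using assms unfolding colorable_def by (meson proper_col_mono lessThan_subset_iff)

lemma clique_card_le:
  assumes "colorable V E n" "clique K E" "K \<subseteq> V" "finite V"
  shows "card K \<le> n"
proof -
  obtain c where c: "proper_col V E {..<n} c" using assms unfolding colorable_def by auto
  then have "inj_on c K" using assms unfolding proper_col_def clique_def inj_on_def by blast
  then have "card K \<le> card {..<n}"
    using c assms by (intro card_inj_on_le[of c]) (auto simp: proper_col_def)
  then show ?thesis by simp
qed

lemma card_image_ge_if_not_colorable:
  assumes "proper_col V E L c" "finite V" "\<And>k. k < n \<Longrightarrow> \<not> colorable V E k"
  shows "n \<le> card (c ` V)"
  using assms colorable_card[OF proper_col_image[OF assms(1)], of "card (c ` V)"]
  by (meson finite_imageI not_le order_refl)

subsection \<open>Simplicial vertices\<close>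

lemma proper_col_extend:
  assumes c: "proper_col (V - {v}) E L c" and "x \<in> L" and sym: "symp E" and nv: "\<not> E v v"
    and x: "\<And>u. u \<in> V \<Longrightarrow> E v u \<Longrightarrow> x \<noteq> c u"
  shows "proper_col V E L (c(v := x))"
  unfolding proper_col_def
proof (intro conjI ballI impI)
  fix u assume "u \<in> V" then show "(c(v := x)) u \<in> L"
    using assms by (cases "u = v") (auto simp: proper_col_def)
next
  fix u w assume uw: "u \<in> V" "w \<in> V" "E u w"
  then have "E w u" using sym by (auto dest: sympD)
  then show "(c(v := x)) u \<noteq> (c(v := x)) w"
    using uw c nv x[of u] x[of w] unfolding proper_col_def by (cases "u = v"; cases "w = v") auto
qed

lemma always_mixing_simplicial:
  assumes fin: "finite V" and sym: "symp E" and irr: "irreflp E" and v: "v \<in> V"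
    and simp: "clique {u\<in>V. E v u} E" and mix: "always_mixing (V - {v}) E"
  shows "always_mixing V E"
  unfolding always_mixing_def mixing_def
proof (intro allI impI)
  fix L n c d
  assume L: "finite L" "n < card L" and col: "colorable V E n"
    and c: "proper_col V E L c" and d: "proper_col V E L d"
  let ?N = "{u\<in>V. E v u}"
  have nv: "\<not> E v v" using irr by (auto dest: irreflpD)
  have "clique (insert v ?N) E" using simp sym unfolding clique_def by (auto dest: sympD)
  then have "card (insert v ?N) \<le> n" using col v fin by (intro clique_card_le) auto
  then have N: "card ?N < n" using fin nv by simp
  have "linked (V - {v}) E L c d"
    using mix L colorable_mono[OF col, of "V - {v}" n] proper_col_mono[OF c] proper_col_mono[OF d]
    by (intro always_mixingD[where n = n]) auto
  \<comment> \<open>The color of \<open>v\<close> is left open: each coloring reached on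
    \<open>V - {v}\<close> is realized on \<open>V\<close> by some extension, and \<open>v\<close>
    gets its prescribed color only at the very end.\<close>
  then have "\<exists>d'. linked V E L c d' \<and> (\<forall>u\<in>V - {v}. d' u = d u)"
  proof (induction rule: rtranclp_induct)
    case base
    then show ?case by auto
  next
    case (step d e)
    then obtain d' where d': "linked V E L c d'" "\<forall>u\<in>V - {v}. d' u = d u" by auto
    from step(2) obtain w where w: "\<forall>u\<in>V - {v} - {w}. d u = e u" and e: "proper_col (V - {v}) E L e"
      unfolding recol_def by auto
    \<comment> \<open>Before \<open>w\<close> takes the color \<open>e w\<close>, \<open>v\<close>
      moves to a color avoiding \<open>e w\<close> and all current colors of its neighbors. At most
      \<open>n - 1\<close> neighbors make this at most \<open>n\<close> forbidden colors.\<close>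
    have finN: "finite (insert (e w) (d ` ?N))" using fin by simp
    have "card (insert (e w) (d ` ?N)) \<le> Suc (card (d ` ?N))" by (rule card_insert_le_m1) auto
    also have "\<dots> \<le> Suc (card ?N)" using fin by (auto intro: card_image_le)
    also have "\<dots> < card L" using N L by simp
    finally have lt: "card (insert (e w) (d ` ?N)) < card L" .
    then obtain x where "x \<in> L" "x \<notin> insert (e w) (d ` ?N)" using ex_not_in_if_card_less[OF finN] by blast
    then have x: "x \<in> L" "x \<noteq> e w" "x \<notin> d ` ?N" by auto
    have xe: "x \<noteq> e u" and xd: "x \<noteq> d u" if u: "u \<in> V" "E v u" for u
    proof -
      have "u \<noteq> v" using u nv by auto
      then show "x \<noteq> e u" using x w u by (cases "u = w") (simp, force)
      show "x \<noteq> d u" using x(3) u by blast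
    qed
    note ext = proper_col_extend[OF _ x(1) sym nv]
    have pd': "proper_col V E L d'" using linked_proper[OF d'(1) c] .
    have p1: "proper_col V E L (d'(v := x))"
    proof (rule ext[OF proper_col_mono[OF pd']])
      show "x \<noteq> d' u" if "u \<in> V" "E v u" for u
        using xd[OF that] d'(2) that nv by (cases "u = v") auto
    qed auto
    have p2: "proper_col V E L (e(v := x))" using e xe by (rule ext)
    have "linked V E L d' (d'(v := x))" by (rule linked_single[OF pd' p1, where v = v]) auto
    moreover have "linked V E L (d'(v := x)) (e(v := x))"
      using d'(2) w by (intro linked_single[OF p1 p2, where v = w]) auto
    ultimately have "linked V E L c (e(v := x))" using d'(1) by (meson rtranclp_trans)
    moreover have "\<forall>u\<in>V - {v}. (e(v := x)) u = e u" by simp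
    ultimately show ?case by blast
  qed
  then obtain d' where d': "linked V E L c d'" "\<forall>u\<in>V - {v}. d' u = d u" by auto
  moreover have "linked V E L d' d"
    using d' by (intro linked_single[OF linked_proper[OF d'(1) c] d, where v = v]) auto
  ultimately show "linked V E L c d" by (meson rtranclp_trans)
qed

subsection \<open>Modules\<close>

text \<open>Two nonadjacent vertices share a color and every other vertex has its own.\<close>

lemma colorable_pred_if_not_clique:
  assumes "finite M" "\<not> clique M E" and sym: "symp E" and irr: "irreflp E"
  shows "colorable M E (card M - 1)"
proof -
  obtain x y where xy: "x \<in> M" "y \<in> M" "x \<noteq> y" "\<not> E x y" using assms unfolding clique_def by blast
  have yx: "\<not> E y x" using xy sym by (auto dest: sympD)
  obtain f :: "'a \<Rightarrow> nat" where f: "inj_on f M"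
    using ex_bij_betw_finite_nat[OF assms(1)] bij_betw_def by metis
  have fy: "f u \<noteq> f y" if "u \<in> M" "E u x \<or> E x u" for u
    using that xy yx f by (metis inj_onD)
  have "proper_col M E (f ` (M - {x})) (f(x := f y))"
    unfolding proper_col_def
  proof (intro conjI ballI impI)
    fix u v assume uv: "u \<in> M" "v \<in> M" "E u v"
    then have "u \<noteq> v" using irr by (auto dest: irreflpD)
    then show "(f(x := f y)) u \<noteq> (f(x := f y)) v"
      using uv fy[of u] fy[of v] f by (auto dest: inj_onD)
  qed (use xy in auto)
  moreover have "card (f ` (M - {x})) = card M - 1"
    using xy(1) assms(1) by (subst card_image) (auto intro: inj_on_subset[OF f])
  ultimately show ?thesis using assms(1) by (intro colorable_card) auto
qed

text \<open>Meant for the vertex set \<open>V - M \<union> K\<close> with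
  \<open>K \<subseteq> M\<close>: the vertices of the clique are borrowed from \<open>M\<close>.
  Their edges to the outside are those of \<open>E\<close>, the same for every vertex of the
  module.\<close>

definition clique_quotient :: "'a set \<Rightarrow> ('a \<Rightarrow> 'a \<Rightarrow> bool) \<Rightarrow> 'a \<Rightarrow> 'a \<Rightarrow> bool" where
  "clique_quotient K E x y \<longleftrightarrow> (if x \<in> K \<and> y \<in> K then x \<noteq> y else E x y)"

text \<open>
  The module \<open>M\<close> is replaced by a clique \<open>K\<close> with as many vertices as \<open>M\<close> needs colors. A coloring
  of the quotient and a partition \<open>p\<close> of \<open>M\<close> into independent classes indexed by \<open>K\<close> lift to a
  coloring of \<open>V\<close>, and recoloring one vertex of \<open>K\<close> lifts to recoloring an independent set. Every
  coloring can be brought into lifted form by recoloring \<open>M\<close> within its own palette. The partition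
  \<open>p\<close> is changed while the quotient leaves one color unused.
\<close>

lemma always_mixing_module:
  assumes fin: "finite V" and sym: "symp E" and irr: "irreflp E"
    and mod: "is_module V E M" and ncl: "\<not> clique M E"
    and mixM: "always_mixing M E"
    and quot: "\<And>K. K \<subset> M \<Longrightarrow> always_mixing (V - M \<union> K) (clique_quotient K E)"
  shows "always_mixing V E"
proof -
  have MV: "M \<subseteq> V" and homog: "\<And>z x y. z \<in> V \<Longrightarrow> z \<notin> M \<Longrightarrow> x \<in> M \<Longrightarrow> y \<in> M \<Longrightarrow> E z x \<Longrightarrow> E z y"
    using mod unfolding is_module_def by blast+
  have homog': "E x z \<Longrightarrow> E y z" if "z \<in> V" "z \<notin> M" "x \<in> M" "y \<in> M" for x y z
    using homog[OF that] sym by (blast dest: sympD)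
  have finM: "finite M" using fin MV finite_subset by auto
  define m where "m = (LEAST k. colorable M E k)"
  note colM1 = colorable_pred_if_not_clique[OF finM ncl sym irr]
  have colm: "colorable M E m" unfolding m_def using colM1 by (rule LeastI)
  have notcol: "\<And>k. k < m \<Longrightarrow> \<not> colorable M E k" unfolding m_def by (rule not_less_Least)
  have Mne: "M \<noteq> {}" using ncl unfolding clique_def by auto
  have "m \<le> card M - 1" unfolding m_def using colM1 by (rule Least_le)
  then have mM: "m < card M" using Mne finM card_gt_0_iff[of M] by linarith
  obtain K where K: "K \<subseteq> M" "card K = m" "finite K"
    using obtain_subset_with_card_n[of m M] mM by auto
  have KM: "K \<subset> M" using K mM by auto
  have Kne: "K \<noteq> {}"
  proof
    assume "K = {}"
    then have "colorable M E 0" using K colm by auto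
    then show False using Mne unfolding colorable_def proper_col_def by auto
  qed
  let ?V = "V - M \<union> K" and ?E = "clique_quotient K E"
  define lift where "lift = (\<lambda>(g :: 'a \<Rightarrow> nat) p x. if x \<in> M then g (p x) else g x)"
  \<comment> \<open>That is, \<open>p\<close> is a proper coloring of \<open>M\<close> whose colors
    are the vertices of \<open>K\<close>.\<close>
  define good where "good = (\<lambda>p. (\<forall>x\<in>M. p x \<in> K) \<and> (\<forall>x\<in>M. \<forall>y\<in>M. E x y \<longrightarrow> p x \<noteq> p y))"
  have lift_proper: "proper_col V E L (lift g p)" if g: "proper_col ?V ?E L g" and p: "good p" for L g p
    unfolding proper_col_def
  proof (intro conjI ballI impI)
    fix u assume "u \<in> V" then show "lift g p u \<in> L"
      using g p unfolding lift_def good_def proper_col_def by auto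
  next
    fix u v assume uv: "u \<in> V" "v \<in> V" "E u v"
    have inj: "g a \<noteq> g b" if "a \<in> K" "b \<in> K" "a \<noteq> b" for a b
      using g that unfolding proper_col_def clique_quotient_def by auto
    have out: "g a \<noteq> g b" if "a \<in> ?V" "b \<in> ?V" "E a b" "a \<notin> K \<or> b \<notin> K" for a b
      using g that unfolding proper_col_def clique_quotient_def by auto
    consider "u \<in> M" "v \<in> M" | "u \<in> M" "v \<notin> M" | "u \<notin> M" "v \<in> M" | "u \<notin> M" "v \<notin> M" by blast
    then show "lift g p u \<noteq> lift g p v"
    proof cases
      case 1
      then show ?thesis using uv inj[of "p u" "p v"] p unfolding lift_def good_def by auto
    next
      case 2
      then have "p u \<in> K" "v \<notin> K" using p K unfolding good_def by auto
      moreover have "E (p u) v" using homog'[of v u "p u"] uv 2 \<open>p u \<in> K\<close> K by auto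
      ultimately show ?thesis using out[of "p u" v] 2 uv unfolding lift_def by auto
    next
      case 3
      then have "p v \<in> K" "u \<notin> K" using p K unfolding good_def by auto
      moreover have "E u (p v)" using homog[of u v "p v"] uv 3 \<open>p v \<in> K\<close> K by auto
      ultimately show ?thesis using out[of u "p v"] 3 uv unfolding lift_def by auto
    next
      case 4
      then show ?thesis using out[of u v] uv K unfolding lift_def by auto
    qed
  qed
  have lift_linked: "linked V E L (lift g p) (lift h p)"
    if gh: "linked ?V ?E L g h" and p: "good p" for L g h p
    using gh
  proof (induction rule: rtranclp_induct)
    case (step h i)
    obtain w where w: "\<forall>u\<in>?V - {w}. h u = i u" and pr: "proper_col ?V ?E L h" "proper_col ?V ?E L i"
      using step(2) unfolding recol_def by auto
    \<comment> \<open>The vertices whose lifted color is read off at \<open>w\<close>: a class of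
      \<open>p\<close> if \<open>w \<in> K\<close>, only \<open>w\<close> itself if
      \<open>w \<in> V - M\<close>, and none otherwise. In each case the set is independent.\<close>
    let ?I = "{x \<in> V. (if x \<in> M then p x else x) = w}"
    have "linked V E L (lift h p) (lift i p)"
    proof (rule linked_if_differ_on_independent[where I = ?I])
      show "\<not> E u v" if "u \<in> ?I" "v \<in> ?I" for u v
      proof (cases "w \<in> M")
        case True
        then have "u \<in> M" "v \<in> M" "p u = p v" using that by (auto split: if_splits)
        then show ?thesis using p unfolding good_def by metis
      next
        case False
        then have "u = w" "v = w" using that p K unfolding good_def by (auto split: if_splits)
        then show ?thesis using irr by (auto dest: irreflpD)
      qed
      show "lift h p u = lift i p u" if "u \<in> V" "u \<notin> ?I" for u
        using that w p K unfolding lift_def good_def by (auto split: if_splits)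
    qed (use fin pr p lift_proper in auto)
    then show ?case using step.IH by (meson rtranclp_trans)
  qed simp
  \<comment> \<open>An outside vertex adjacent to one vertex of \<open>M\<close> is adjacent to all
    of them. Hence \<open>M\<close> may be recolored freely within the colors it already
    uses.\<close>
  have palette: "c z \<notin> c ` M"
    if "proper_col V E L c" "z \<in> V - M" "x \<in> M" "E z x" for L c z x
    using that homog[of z x] MV unfolding proper_col_def by blast
  have lifted: "\<exists>g p. proper_col ?V ?E L g \<and> good p \<and> linked V E L c (lift g p)"
    if c: "proper_col V E L c" and L: "finite L" for L c
  proof -
    have cM: "proper_col M E (c ` M) c" using proper_col_image[OF proper_col_mono[OF c MV order_refl]] .
    have "m \<le> card (c ` M)" using card_image_ge_if_not_colorable[OF cM finM] notcol by auto
    \<comment> \<open>If \<open>M\<close> shows more than \<open>m\<close> colors, these form a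
      palette with a color to spare, and \<open>mixM\<close> applies inside it; if it shows exactly
      \<open>m\<close>, nothing has to be done.\<close>
    have "\<exists>d. linked V E L c d \<and> card (d ` M) = m"
    proof (cases "card (c ` M) = m")
      case False
      then have lt: "m < card (c ` M)" using \<open>m \<le> card (c ` M)\<close> by simp
      obtain P d where d: "P \<subseteq> c ` M" "finite P" "card P = m" "proper_col M E P d"
        using colorable_obtain[OF colm, of "c ` M"] lt finM by auto
      have "linked M E (c ` M) c d"
        using always_mixingD[OF mixM _ lt colm cM proper_col_mono[OF d(4)]] d finM by auto
      then have "linked V E L (override_on c c M) (override_on c d M)"
        using c palette[OF c] MV
        by (intro linked_override[OF MV _ sym]) (auto simp: proper_col_def)
      moreover have "override_on c c M = c" by (auto simp: override_on_def)
      moreover have "card (override_on c d M ` M) = m"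
      proof -
        have "override_on c d M ` M = d ` M" by auto
        moreover have "d ` M \<subseteq> P" using d unfolding proper_col_def by auto
        then have "card (d ` M) \<le> m" using card_mono d by metis
        moreover have "m \<le> card (d ` M)" using card_image_ge_if_not_colorable[OF d(4) finM] notcol by auto
        ultimately show ?thesis by simp
      qed
      ultimately show ?thesis by auto
    qed auto
    then obtain d where d: "linked V E L c d" "card (d ` M) = m" by auto
    have dp: "proper_col V E L d" using linked_proper[OF d(1) c] .
    \<comment> \<open>Both sets have \<open>m\<close> elements, so each color on \<open>M\<close> is
      represented by a vertex of \<open>K\<close>; \<open>p\<close> sends a vertex of
      \<open>M\<close> to the representative of its color.\<close>
    obtain f where f: "bij_betw f K (d ` M)"
      using K d(2) finM by (metis bij_betw_iff_card finite_imageI)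
    define g where "g = (\<lambda>x. if x \<in> K then f x else d x)"
    define p where "p = (\<lambda>x. the_inv_into K f (d x))"
    have pK: "p x \<in> K" and fp: "f (p x) = d x" if "x \<in> M" for x
      using f that unfolding p_def bij_betw_def
      by (auto intro: the_inv_into_into f_the_inv_into_f)
    have gp: "good p"
      unfolding good_def
    proof (intro conjI ballI impI)
      fix x y assume xy: "x \<in> M" "y \<in> M" "E x y"
      then have "d x \<noteq> d y" using dp MV unfolding proper_col_def by auto
      then show "p x \<noteq> p y" using fp xy by metis
    qed (use pK in auto)
    have dL: "\<And>y. y \<in> V \<Longrightarrow> d y \<in> L" using dp unfolding proper_col_def by auto
    have fK: "\<exists>y\<in>M. f k = d y" if "k \<in> K" for k using f that unfolding bij_betw_def by auto
    have pg: "proper_col ?V ?E L g"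
      unfolding proper_col_def
    proof (intro conjI ballI impI)
      fix u assume "u \<in> ?V" then show "g u \<in> L"
        using dL fK[of u] MV unfolding g_def by (auto; blast)
    next
      fix u v assume uv: "u \<in> ?V" "v \<in> ?V" "?E u v"
      consider "u \<in> K" "v \<in> K" | "u \<in> K" "v \<notin> K" | "u \<notin> K" "v \<in> K" | "u \<notin> K" "v \<notin> K" by blast
      then show "g u \<noteq> g v"
      proof cases
        case 1
        then show ?thesis using uv f unfolding g_def clique_quotient_def bij_betw_def
          by (auto dest: inj_onD)
      next
        case 2
        then obtain y where y: "y \<in> M" "f u = d y" using fK by auto
        have v: "v \<in> V" "v \<notin> M" using 2 uv by auto
        then have "E y v" using 2 uv y K homog'[of v u y] unfolding clique_quotient_def by auto
        then show ?thesis using dp y v 2 MV unfolding g_def proper_col_def by auto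
      next
        case 3
        then obtain y where y: "y \<in> M" "f v = d y" using fK by auto
        have u: "u \<in> V" "u \<notin> M" using 3 uv by auto
        then have "E u y" using 3 uv y K homog[of u v y] unfolding clique_quotient_def by auto
        then show ?thesis using dp y u 3 MV unfolding g_def proper_col_def by auto
      next
        case 4
        then show ?thesis using uv dp unfolding g_def proper_col_def clique_quotient_def by auto
      qed
    qed
    have "lift g p x = d x" for x using pK[of x] fp[of x] K unfolding lift_def g_def by auto
    then have "lift g p = d" by auto
    then show ?thesis using pg gp d by auto
  qed
  show ?thesis unfolding always_mixing_def mixing_def
  proof (intro allI impI)
    fix L n c d
    assume L: "finite L" "n < card L" and col: "colorable V E n"
      and c: "proper_col V E L c" and d: "proper_col V E L d"
    \<comment> \<open>Here \<open>lifted\<close> serves another purpose: applied to a coloring with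
      \<open>n\<close> colors, it shows that \<open>n\<close> colors suffice for the
      quotient.\<close>
    obtain e where e: "proper_col V E {..<n} e" using col unfolding colorable_def by auto
    obtain g0 p0 where "proper_col ?V ?E {..<n} g0" using lifted[OF e] by auto
    then have colQ: "colorable ?V ?E n" unfolding colorable_def by auto
    obtain g p where g: "proper_col ?V ?E L g" "good p" "linked V E L c (lift g p)"
      using lifted[OF c L(1)] by auto
    obtain h q where h: "proper_col ?V ?E L h" "good q" "linked V E L d (lift h q)"
      using lifted[OF d L(1)] by auto
    \<comment> \<open>The common target \<open>r\<close> occupies only \<open>n\<close> colors,
      which leaves \<open>x\<close> for turning \<open>p\<close> into \<open>q\<close>.\<close>
    obtain P r where r: "P \<subseteq> L" "finite P" "card P = n" "proper_col ?V ?E P r"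
      using colorable_obtain[OF colQ L(1)] L by auto
    have rL: "proper_col ?V ?E L r" using proper_col_mono[OF r(4)] r by auto
    obtain x where x: "x \<in> L" "x \<notin> P" using r L
      by (metis card_mono less_le_not_le subsetI)
    have gr: "linked V E L (lift g p) (lift r p)"
      using lift_linked[OF always_mixingD[OF quot[OF KM] L colQ g(1) rL] g(2)] .
    have hr: "linked V E L (lift h q) (lift r q)"
      using lift_linked[OF always_mixingD[OF quot[OF KM] L colQ h(1) rL] h(2)] .
    \<comment> \<open>The \<open>m\<close> colors of \<open>r\<close> on \<open>K\<close> together
      with \<open>x\<close>: one color more than \<open>M\<close> requires, and none of them appears
      on an outside neighbor of \<open>M\<close>.\<close>
    let ?A = "insert x (r ` K)"
    have rK: "inj_on r K"
    proof (rule inj_onI, rule ccontr)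
      fix a b assume ab: "a \<in> K" "b \<in> K" "r a = r b" "a \<noteq> b"
      then have "?E a b" unfolding clique_quotient_def by auto
      then show False using ab r(4) unfolding proper_col_def by blast
    qed
    have rP: "r ` K \<subseteq> P" using r(4) unfolding proper_col_def by auto
    then have "card ?A = Suc m" using rK K x by (subst card_insert_disjoint) (auto simp: card_image)
    moreover have rp: "proper_col M E ?A (r \<circ> p)" if "good p" for p
      unfolding proper_col_def
    proof (intro conjI ballI impI)
      fix u v assume "u \<in> M" "v \<in> M" "E u v"
      then show "(r \<circ> p) u \<noteq> (r \<circ> p) v"
        using that inj_onD[OF rK, of "p u" "p v"] unfolding good_def by auto
    qed (use that in \<open>auto simp: good_def\<close>)
    ultimately have l1: "linked M E ?A (r \<circ> p) (r \<circ> q)"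
      using always_mixingD[OF mixM, of ?A m] colm K g h by auto
    have l2: "proper_col (V - M) E L r"
      unfolding proper_col_def
    proof (intro conjI ballI impI)
      fix u v assume uv: "u \<in> V - M" "v \<in> V - M" "E u v"
      then have "?E u v" using K unfolding clique_quotient_def by auto
      then show "r u \<noteq> r v" using uv rL unfolding proper_col_def by blast
    qed (use rL in \<open>auto simp: proper_col_def\<close>)
    have l3: "r z \<notin> ?A" if z: "z \<in> V - M" "w \<in> M" "E z w" for z w
    proof -
      have "r z \<in> P" using r(4) z unfolding proper_col_def by auto
      moreover have "r z \<noteq> r k" if "k \<in> K" for k
      proof -
        have "?E z k" using homog[of z w k] z that K unfolding clique_quotient_def by auto
        then show ?thesis using r(4) z that unfolding proper_col_def by blast
      qed
      ultimately show ?thesis using x by auto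
    qed
    have l4: "?A \<subseteq> L" using x rP r by auto
    have "linked V E L (override_on r (r \<circ> p) M) (override_on r (r \<circ> q) M)"
      by (rule linked_override[OF MV l4 sym l2 l3 l1])
    moreover have "override_on r (r \<circ> p) M = lift r p" for p
      unfolding lift_def override_on_def by auto
    ultimately have "linked V E L (lift r p) (lift r q)" by simp
    note rtranclp_trans[OF rtranclp_trans[OF g(3) gr] this]
    also note linked_sym[OF rtranclp_trans[OF h(3) hr]]
    finally show "linked V E L c d" .
  qed
qed

subsection \<open>Blow-ups of the 5-cycle\<close>

text \<open>Equality is included because the parts of the blow-up are cliques.\<close>

definition near5 :: "nat \<Rightarrow> nat \<Rightarrow> bool" where
  "near5 i j \<longleftrightarrow> i = j \<or> i = Suc j mod 5 \<or> j = Suc i mod 5"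

definition c5_blowup :: "'a set \<Rightarrow> ('a \<Rightarrow> 'a \<Rightarrow> bool) \<Rightarrow> ('a \<Rightarrow> nat) \<Rightarrow> bool" where
  "c5_blowup V E t \<longleftrightarrow> t ` V = {..<5} \<and> (\<forall>x\<in>V. \<forall>y\<in>V. E x y \<longleftrightarrow> x \<noteq> y \<and> near5 (t x) (t y))"

lemma less5_cases: "i < 5 \<Longrightarrow> i = 0 \<or> i = 1 \<or> i = 2 \<or> i = 3 \<or> i = (4::nat)" by auto

lemma near5_rotate:
  assumes "i < 5" "j < 5"
  shows "near5 ((i + k) mod 5) ((j + k) mod 5) \<longleftrightarrow> near5 i j"
proof -
  have "near5 ((i + l) mod 5) ((j + l) mod 5) \<longleftrightarrow> near5 i j" if "l < 5" for l
    using less5_cases[OF assms(1)] less5_cases[OF assms(2)] less5_cases[OF that]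
    by (elim disjE) (simp_all add: near5_def)
  from this[of "k mod 5"] show ?thesis by (simp add: mod_add_right_eq)
qed

lemma c5_blowup_rotate: assumes "c5_blowup V E t" shows "c5_blowup V E (\<lambda>x. (t x + k) mod 5)"
proof -
  have t: "t ` V = {..<5}" using assms unfolding c5_blowup_def by auto
  then have t5: "t x < 5" if "x \<in> V" for x using that by auto
  have "i \<in> (\<lambda>x. (t x + k) mod 5) ` V" if "i < 5" for i
  proof -
    \<comment> \<open>Modulo 5, adding \<open>4 * k\<close> undoes adding \<open>k\<close>, without
      subtraction on naturals.\<close>
    have "(i + 4 * k) mod 5 \<in> t ` V" using t by auto
    then obtain x where "x \<in> V" "t x = (i + 4 * k) mod 5" by (metis imageE)
    moreover have "((i + 4 * k) mod 5 + k) mod 5 = i" using that by presburger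
    ultimately show ?thesis by (metis image_eqI)
  qed
  then have "(\<lambda>x. (t x + k) mod 5) ` V = {..<5}" by auto
  moreover have "E x y \<longleftrightarrow> x \<noteq> y \<and> near5 ((t x + k) mod 5) ((t y + k) mod 5)" if "x \<in> V" "y \<in> V" for x y
    using assms that near5_rotate[OF t5[OF that(1)] t5[OF that(2)]] unfolding c5_blowup_def by simp
  ultimately show ?thesis unfolding c5_blowup_def by blast
qed

text \<open>Nonadjacent vertices lie in parts at cyclic distance two. Rotating one of them to part 0
  puts the other into part 2 or part 3; in the latter case the roles are exchanged.\<close>

lemma c5_blowup_normalize:
  assumes "c5_blowup V E t" "x \<in> V" "y \<in> V" "x \<noteq> y" "\<not> E x y"
  obtains t' where "c5_blowup V E t'" "(t' x = 0 \<and> t' y = 2) \<or> (t' y = 0 \<and> t' x = 2)"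
proof -
  have t: "t x < 5" "t y < 5" using assms unfolding c5_blowup_def by auto
  have "\<not> near5 (t x) (t y)" using assms unfolding c5_blowup_def by auto
  then have "(t x + (5 - t x)) mod 5 = 0 \<and> (t y + (5 - t x)) mod 5 = 2 \<or>
      (t y + (5 - t y)) mod 5 = 0 \<and> (t x + (5 - t y)) mod 5 = 2"
    using less5_cases[OF t(1)] less5_cases[OF t(2)] by (auto simp: near5_def)
  then show ?thesis using that c5_blowup_rotate[OF assms(1)] by metis
qed

text \<open>Parts 3 and 4 form a clique, so some color \<open>g\<close> is missing there. If
  \<open>g\<close> occurs in part 2, a vertex \<open>x\<close> of part 0 can take it. Otherwise a
  vertex \<open>y\<close> of part 2 takes the color of \<open>x\<close>; the only possible conflict
  is a single vertex \<open>z\<close> of the clique part 3, and it can first be moved to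
  \<open>g\<close>.\<close>

lemma c5_blowup_share_color:
  assumes fin: "finite V" and sym: "symp E" and irr: "irreflp E" and bl: "c5_blowup V E t"
    and L: "finite L" "n < card L" and col: "colorable V E n" and c: "proper_col V E L c"
  shows "\<exists>d x y. linked V E L c d \<and> x \<in> V \<and> y \<in> V \<and> t x = 0 \<and> t y = 2 \<and> d x = d y"
proof (cases "\<exists>x y. x \<in> V \<and> y \<in> V \<and> t x = 0 \<and> t y = 2 \<and> c x = c y")
  case True
  then show ?thesis by auto
next
  case False
  then have ns: "\<And>x y. x \<in> V \<Longrightarrow> y \<in> V \<Longrightarrow> t x = 0 \<Longrightarrow> t y = 2 \<Longrightarrow> c x \<noteq> c y" by blast
  have irr': "\<not> E x x" for x using irr by (auto dest: irreflpD)
  have tV: "t ` V = {..<5}" and E: "\<And>x y. x \<in> V \<Longrightarrow> y \<in> V \<Longrightarrow> E x y \<longleftrightarrow> x \<noteq> y \<and> near5 (t x) (t y)"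
    using bl unfolding c5_blowup_def by auto
  have t5: "t x = 0 \<or> t x = 1 \<or> t x = 2 \<or> t x = 3 \<or> t x = 4" if "x \<in> V" for x
  proof -
    have "t x < 5" using that tV by auto
    then show ?thesis by arith
  qed
  have proper: "\<And>u v. u \<in> V \<Longrightarrow> v \<in> V \<Longrightarrow> E u v \<Longrightarrow> c u \<noteq> c v" and cL: "\<And>u. u \<in> V \<Longrightarrow> c u \<in> L"
    using c unfolding proper_col_def by auto
  have recolor: "proper_col V E L (b(v := g)) \<and> linked V E L b (b(v := g))"
    if "proper_col V E L b" "v \<in> V" "g \<in> L" "\<And>u. u \<in> V \<Longrightarrow> E v u \<Longrightarrow> g \<noteq> b u" for b v g
  proof -
    have "proper_col V E L (b(v := g))"
      using that proper_col_mono[of V E L b "V - {v}" L] by (intro proper_col_extend sym irr') auto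
    then show ?thesis using that linked_single[of V E L b "b(v := g)" v] by auto
  qed
  have "0 \<in> t ` V" "2 \<in> t ` V" using tV by auto
  then obtain x y where x: "x \<in> V" "t x = 0" and y: "y \<in> V" "t y = 2" by (metis imageE)
  let ?Q = "{z\<in>V. t z = 3 \<or> t z = 4}"
  have "clique ?Q E" unfolding clique_def by (auto simp: E near5_def)
  then have "card ?Q \<le> n" using col fin by (intro clique_card_le) auto
  then have "card (c ` ?Q) < card L" using card_image_le[of ?Q c] fin L by auto
  then obtain g where "g \<in> L" "g \<notin> c ` ?Q" using ex_not_in_if_card_less[of "c ` ?Q" L] fin by auto
  then have g: "g \<in> L" "\<And>z. z \<in> V \<Longrightarrow> t z = 3 \<or> t z = 4 \<Longrightarrow> c z \<noteq> g" by blast+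
  show ?thesis
  proof (cases "\<exists>y'\<in>V. t y' = 2 \<and> c y' = g")
    case True
    then obtain y' where y': "y' \<in> V" "t y' = 2" "c y' = g" by auto
    have "g \<noteq> c u" if u: "u \<in> V" "E x u" for u
    proof -
      have "t u = 0 \<or> t u = 1 \<or> t u = 4" using E[OF x(1) u(1)] u x t5[OF u(1)] by (auto simp: near5_def)
      moreover have "t u = 1 \<Longrightarrow> E u y'" using E[OF u(1) y'(1)] y' by (auto simp: near5_def)
      ultimately show ?thesis using g(2)[OF u(1)] ns[OF u(1) y'(1)] proper[OF u(1) y'(1)] y' by auto
    qed
    then have "linked V E L c (c(x := g))" using recolor[OF c x(1) g(1)] by auto
    moreover have "y' \<noteq> x" using x y' by auto
    ultimately show ?thesis using x y' by (intro exI[of _ "c(x := g)"] exI[of _ x] exI[of _ y']) auto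
  next
    case ng: False
    show ?thesis
    proof (cases "\<exists>z\<in>V. t z = 3 \<and> c z = c x")
      case False
      have "c x \<noteq> c u" if u: "u \<in> V" "E y u" for u
      proof -
        have "t u = 1 \<or> t u = 2 \<or> t u = 3" using E[OF y(1) u(1)] u y t5[OF u(1)] by (auto simp: near5_def)
        moreover have "t u = 1 \<Longrightarrow> E x u" using E[OF x(1) u(1)] x by (auto simp: near5_def)
        ultimately show ?thesis using False ns[OF x(1) u(1)] proper[OF x(1) u(1)] x u by auto
      qed
      then have "linked V E L c (c(y := c x))" using recolor[OF c y(1) cL[OF x(1)]] by auto
      moreover have "y \<noteq> x" using x y by auto
      ultimately show ?thesis using x y by (intro exI[of _ "c(y := c x)"] exI[of _ x] exI[of _ y]) auto
    next
      case True
      then obtain z where z: "z \<in> V" "t z = 3" "c z = c x" by auto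
      have "g \<noteq> c u" if u: "u \<in> V" "E z u" for u
      proof -
        have "t u = 2 \<or> t u = 3 \<or> t u = 4" using E[OF z(1) u(1)] u z t5[OF u(1)] by (auto simp: near5_def)
        then show ?thesis using ng g(2)[OF u(1)] u by auto
      qed
      then have c1: "proper_col V E L (c(z := g))" "linked V E L c (c(z := g))"
        using recolor[OF c z(1) g(1)] by auto
      have "c x \<noteq> (c(z := g)) u" if u: "u \<in> V" "E y u" for u
      proof -
        have tu: "t u = 1 \<or> t u = 2 \<or> t u = 3" using E[OF y(1) u(1)] u y t5[OF u(1)] by (auto simp: near5_def)
        moreover have "t u = 1 \<Longrightarrow> E x u" using E[OF x(1) u(1)] x by (auto simp: near5_def)
        moreover have "t u = 3 \<Longrightarrow> u \<noteq> z \<Longrightarrow> E z u" using E[OF z(1) u(1)] z by (auto simp: near5_def)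
        moreover have "c x \<noteq> g" using g(2)[OF z(1)] z by auto
        ultimately show ?thesis
          using z ns[OF x(1) u(1)] proper[OF x(1) u(1)] proper[OF z(1) u(1)] x by (cases "u = z") auto
      qed
      then have "linked V E L (c(z := g)) (c(z := g, y := c x))"
        using recolor[OF c1(1) y(1) cL[OF x(1)]] by auto
      then have "linked V E L c (c(z := g, y := c x))" using c1(2) by (meson rtranclp_trans)
      moreover have "y \<noteq> x" "z \<noteq> x" using x y z by auto
      ultimately show ?thesis
        using x y by (intro exI[of _ "c(z := g, y := c x)"] exI[of _ x] exI[of _ y]) auto
    qed
  qed
qed

text \<open>
  Let \<open>{x, y}\<close> be a color class of an optimal coloring. Removing it, or any other pair from the same
  two parts, lowers the chromatic number, so once such a pair is monochromatic the rest can be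
  recolored without the color of the pair and with one further color to spare.
\<close>

lemma always_mixing_c5_blowup:
  assumes fin: "finite V" and sym: "symp E" and irr: "irreflp E" and bl0: "c5_blowup V E t0"
    and IH: "\<And>W. W \<subset> V \<Longrightarrow> always_mixing W E"
  shows "always_mixing V E"
  unfolding always_mixing_def mixing_def
proof (intro allI impI)
  fix L n c0 d0
  assume L: "finite L" "n < card L" and col: "colorable V E n"
    and c0: "proper_col V E L c0" and d0: "proper_col V E L d0"
  have irr': "\<not> E x x" for x using irr by (auto dest: irreflpD)
  have sym': "E x y \<Longrightarrow> E y x" for x y using sym by (auto dest: sympD)
  define m where "m = (LEAST k. colorable V E k)"
  have colm: "colorable V E m" unfolding m_def using col by (rule LeastI)
  have mn: "m \<le> n" unfolding m_def using col by (rule Least_le)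
  \<comment> \<open>This yields \<open>m < card V\<close>, so an optimal coloring is not injective
    and provides the monochromatic pair.\<close>
  have "\<not> clique V E"
  proof -
    have "0 \<in> t0 ` V" "2 \<in> t0 ` V" using bl0 unfolding c5_blowup_def by auto
    then obtain a b where ab: "a \<in> V" "t0 a = 0" "b \<in> V" "t0 b = 2" by (metis imageE)
    then have "\<not> near5 (t0 a) (t0 b)" "a \<noteq> b" by (auto simp: near5_def)
    then have "\<not> E a b" using bl0 ab unfolding c5_blowup_def by blast
    then show ?thesis using ab \<open>a \<noteq> b\<close> unfolding clique_def by blast
  qed
  then have "m \<le> card V - 1"
    unfolding m_def by (intro Least_le colorable_pred_if_not_clique fin sym irr)
  moreover have "V \<noteq> {}" using bl0 lessThan_empty_iff[of "5 :: nat"] unfolding c5_blowup_def by auto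
  ultimately have mV: "m < card V" using fin card_gt_0_iff[of V] by linarith
  obtain \<kappa> where \<kappa>: "proper_col V E {..<m} \<kappa>" using colm unfolding colorable_def by auto
  have "\<not> inj_on \<kappa> V"
  proof
    assume "inj_on \<kappa> V"
    then have "card V \<le> card {..<m}" using \<kappa> by (intro card_inj_on_le) (auto simp: proper_col_def)
    then show False using mV by simp
  qed
  then obtain x0 y0 where xy0: "x0 \<in> V" "y0 \<in> V" "x0 \<noteq> y0" "\<kappa> x0 = \<kappa> y0" unfolding inj_on_def by blast
  then have "\<not> E x0 y0" using \<kappa> unfolding proper_col_def by blast
  then obtain t where bl: "c5_blowup V E t"
    and "(t x0 = 0 \<and> t y0 = 2) \<or> (t y0 = 0 \<and> t x0 = 2)"
    using c5_blowup_normalize[OF bl0 xy0(1-3)] by blast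
  then obtain x y where xy: "x \<in> V" "y \<in> V" "t x = 0" "t y = 2" "\<kappa> x = \<kappa> y" using xy0 by metis
  have E: "E u v \<longleftrightarrow> u \<noteq> v \<and> near5 (t u) (t v)" if "u \<in> V" "v \<in> V" for u v
    using bl that unfolding c5_blowup_def by blast
  have t5: "t u = 0 \<or> t u = 1 \<or> t u = 2 \<or> t u = 3 \<or> t u = 4" if "u \<in> V" for u
  proof -
    have "t u < 5" using that bl unfolding c5_blowup_def by auto
    then show ?thesis by arith
  qed
  \<comment> \<open>The closed neighborhoods of parts 0 and 2 cover the cycle, so a color shared by
    \<open>a\<close> and \<open>b\<close> appears on no other vertex.\<close>
  have dominated: "E u a \<or> E u b"
    if "a \<in> V" "b \<in> V" "t a = 0" "t b = 2" "u \<in> V - {a, b}" for a b u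
    using E[of u a] E[of u b] that t5[of u] by (auto simp: near5_def)
  have nonadj: "\<not> E a b" if "a \<in> V" "b \<in> V" "t a = 0" "t b = 2" for a b
    using E[of a b] that by (auto simp: near5_def)
  have \<kappa>m: "\<kappa> x < m" using \<kappa> xy unfolding proper_col_def by auto
  define k where "k = m - 1"
  have k: "Suc k = m" unfolding k_def using \<kappa>m by simp
  have colk: "colorable (V - {a, b}) E k" if ab: "a \<in> V" "b \<in> V" "t a = 0" "t b = 2" for a b
  proof -
    \<comment> \<open>The vertices \<open>x\<close>, \<open>a\<close> are twins, and so are
      \<open>y\<close>, \<open>b\<close>. Where \<open>x\<close> and \<open>y\<close> survive, they
      inherit the colors of \<open>a\<close> and \<open>b\<close>; the color
      \<open>\<kappa> x\<close> then disappears.\<close>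
    let ?f = "\<lambda>z. if z = x then \<kappa> a else if z = y then \<kappa> b else \<kappa> z"
    have twin: "E z w \<longleftrightarrow> E z w'" if "z \<in> V" "w \<in> V" "w' \<in> V" "t w = t w'" "z \<noteq> w" "z \<noteq> w'" for z w w'
      using E[of z w] E[of z w'] that by auto
    have tw: "E w w'" if "w \<in> V" "w' \<in> V" "t w = t w'" "w \<noteq> w'" for w w'
      using E[of w w'] that by (auto simp: near5_def)
    have pr: "\<kappa> u \<noteq> \<kappa> v" if "u \<in> V" "v \<in> V" "E u v" for u v
      using that \<kappa> unfolding proper_col_def by auto
    have lt: "\<kappa> u < m" if "u \<in> V" for u using that \<kappa> unfolding proper_col_def by auto
    have "proper_col (V - {a, b}) E ({..<m} - {\<kappa> x}) ?f"
      unfolding proper_col_def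
    proof (intro conjI ballI impI)
      fix u assume u: "u \<in> V - {a, b}"
      have "\<kappa> a \<noteq> \<kappa> x" if "u = x" using that u tw[of a x] pr[of a x] ab xy by auto
      moreover have "\<kappa> b \<noteq> \<kappa> x" if "u = y" using that u tw[of b y] pr[of b y] ab xy by auto
      moreover have "\<kappa> u \<noteq> \<kappa> x" if "u \<noteq> x" "u \<noteq> y"
        using that u dominated[of x y u] pr[of u x] pr[of u y] xy by auto
      ultimately show "?f u \<in> {..<m} - {\<kappa> x}" using lt[of a] lt[of b] lt[of u] ab u by auto
    next
      have main: "?f u \<noteq> ?f v"
        if u: "u \<in> V - {a, b}" and v: "v \<in> V - {a, b}" and e: "E u v" and vx: "v \<noteq> x" "v \<noteq> y" for u v
      proof -
        have "E v a" if "u = x" using that u v e sym' twin[of v x a] ab xy vx by auto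
        moreover have "E v b" if "u = y" using that u v e sym' twin[of v y b] ab xy vx by auto
        ultimately show ?thesis using pr[of v a] pr[of v b] pr[of u v] u v e vx ab by auto
      qed
      fix u v assume uv: "u \<in> V - {a, b}" "v \<in> V - {a, b}" "E u v"
      have "\<not> E x y" "\<not> E y x" using nonadj[of x y] sym' xy by auto
      then have "v \<noteq> x \<and> v \<noteq> y \<or> u \<noteq> x \<and> u \<noteq> y" using uv(3) irr' by metis
      then show "?f u \<noteq> ?f v"
      proof
        assume "v \<noteq> x \<and> v \<noteq> y"
        then show ?thesis by (intro main[OF uv]) auto
      next
        assume "u \<noteq> x \<and> u \<noteq> y"
        then show ?thesis by (intro main[OF uv(2,1) sym'[OF uv(3)], THEN not_sym]) auto
      qed
    qed
    moreover have "card ({..<m} - {\<kappa> x}) = k" using \<kappa>m k by simp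
    ultimately show ?thesis by (intro colorable_card) auto
  qed
  have palette: "\<exists>P h. P \<subseteq> S \<and> finite P \<and> card P = k \<and> proper_col (V - {a, b}) E P h"
    if "a \<in> V" "b \<in> V" "t a = 0" "t b = 2" "S \<subseteq> L" "k \<le> card S" for a b S
    using colorable_obtain[OF colk[OF that(1-4)] finite_subset[OF that(5) L(1)] that(6)] by metis
  \<comment> \<open>With \<open>a\<close> and \<open>b\<close> frozen at \<open>e\<close>, the other
    vertices use \<open>L - {e}\<close>, which has more than \<open>k\<close> colors, while
    \<open>k\<close> suffice for them; so the induction hypothesis applies.\<close>
  have rest: "\<exists>d. linked V E L c d \<and> d a = e \<and> d b = e \<and> (\<forall>u\<in>V - {a, b}. d u = h u)"
    if ab: "a \<in> V" "b \<in> V" "t a = 0" "t b = 2" and c: "proper_col V E L c" "c a = e" "c b = e"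
      and h: "proper_col (V - {a, b}) E (L - {e}) h" for a b c e h
  proof -
    let ?W = "V - {a, b}"
    have "c u \<noteq> e" if "u \<in> ?W" for u
    proof -
      have "\<And>v. v \<in> V \<Longrightarrow> E u v \<Longrightarrow> c u \<noteq> c v" using c(1) that unfolding proper_col_def by blast
      then show ?thesis using dominated[OF ab that] c ab by metis
    qed
    then have cW: "proper_col ?W E (L - {e}) c" using c unfolding proper_col_def by auto
    have "e \<in> L" using c ab unfolding proper_col_def by auto
    then have "k < card (L - {e})" using L mn k by simp
    then have lk: "linked ?W E (L - {e}) c h"
      using IH[of ?W] ab L colk[OF ab] cW h by (intro always_mixingD[of ?W E "L - {e}" k]) auto
    have "linked V E L (override_on c c ?W) (override_on c h ?W)"
      by (rule linked_override[OF _ _ sym _ _ lk]) (use c in \<open>auto intro: proper_col_mono\<close>)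
    moreover have "override_on c c ?W = c" by (auto simp: override_on_def)
    ultimately show ?thesis using c by (intro exI[of _ "override_on c h ?W"]) auto
  qed
  have pair: "proper_col V E L (c(x := d, y := d)) \<and> linked V E L c (c(x := d, y := d))"
    if c: "proper_col V E L c" and d: "d \<in> L" "\<And>u. u \<in> V - {x, y} \<Longrightarrow> c u \<noteq> d" for c d
  proof -
    have nxy: "\<not> E x y" "\<not> E y x" using nonadj[of x y] sym' xy by auto
    have "proper_col V E L (c(x := d, y := d))"
      unfolding proper_col_def
    proof (intro conjI ballI impI)
      fix u v assume uv: "u \<in> V" "v \<in> V" "E u v"
      then have "\<not> (u \<in> {x, y} \<and> v \<in> {x, y})" using nxy irr' by auto
      then show "(c(x := d, y := d)) u \<noteq> (c(x := d, y := d)) v"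
        using uv d(2)[of u] d(2)[of v] c unfolding proper_col_def by auto
    qed (use c d in \<open>auto simp: proper_col_def\<close>)
    moreover from this have "linked V E L c (c(x := d, y := d))"
      by (intro linked_if_differ_on_independent[of "{x, y}"] c) (use nxy irr' in auto)
    ultimately show ?thesis by simp
  qed
  \<comment> \<open>The color \<open>e0\<close> and the coloring \<open>h0\<close> are fixed once
    and for all; they define the coloring \<open>c1\<close> to which every coloring gets
    linked.\<close>
  obtain e0 where e0: "e0 \<in> L" using L by fastforce
  have "k \<le> card (L - {e0})" using L mn k e0 by simp
  then obtain P0 h0 where h0: "P0 \<subseteq> L - {e0}" "proper_col (V - {x, y}) E P0 h0"
    using palette[OF xy(1-4) Diff_subset \<open>k \<le> card (L - {e0})\<close>] by blast
  define c1 where "c1 = h0(x := e0, y := e0)"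
  have canon: "linked V E L c c1" if c: "proper_col V E L c" for c
  proof -
    obtain d a b where d: "linked V E L c d" and ab: "a \<in> V" "b \<in> V" "t a = 0" "t b = 2" "d a = d b"
      using c5_blowup_share_color[OF fin sym irr bl L col c] by blast
    have dp: "proper_col V E L d" using linked_proper[OF d c] .
    let ?e = "d a"
    have eL: "?e \<in> L" using dp ab unfolding proper_col_def by auto
    have kL: "k < card (L - {?e})" using L mn k eL by simp
    obtain P h where P: "P \<subseteq> L - {?e}" "finite P" "card P = k" and h: "proper_col (V - {a, b}) E P h"
      using palette[OF ab(1-4) Diff_subset less_imp_le[OF kL]] by blast
    obtain f where f: "linked V E L d f" "f a = ?e" "f b = ?e" "\<forall>u\<in>V - {a, b}. f u = h u"
      using rest[OF ab(1-4) dp refl ab(5)[symmetric] proper_col_mono[OF h order_refl P(1)]] by blast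
    obtain e where e: "e \<in> L - {?e}" "e \<notin> P" using ex_not_in_if_card_less[of P "L - {?e}"] P kL by auto
    have "f u \<noteq> e" if "u \<in> V" for u
      using that f h e unfolding proper_col_def by (cases "u = a \<or> u = b") auto
    then have g: "proper_col V E L (f(x := e, y := e))" "linked V E L f (f(x := e, y := e))"
      using pair[OF linked_proper[OF f(1) dp], of e] e by auto
    \<comment> \<open>Since \<open>card L\<close> is at least \<open>k + 2\<close>, the rest can be
      recolored without \<open>e\<close> and \<open>e0\<close>, which clears \<open>e0\<close> for
      \<open>x\<close> and \<open>y\<close>.\<close>
    have "card L - 2 \<le> card (L - {e, e0})"
      using diff_card_le_card_Diff[of "{e, e0}" L] card_insert_le_m1[of 2 "{e0}" e] by auto
    then have "k \<le> card (L - {e, e0})" using L mn k by simp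
    then obtain P1 h1 where h1: "P1 \<subseteq> L - {e, e0}" "proper_col (V - {x, y}) E P1 h1"
      using palette[OF xy(1-4) Diff_subset \<open>k \<le> card (L - {e, e0})\<close>] by blast
    have h1e: "proper_col (V - {x, y}) E (L - {e}) h1"
      by (rule proper_col_mono[OF h1(2) order_refl]) (use h1(1) in blast)
    have gxy: "(f(x := e, y := e)) x = e" "(f(x := e, y := e)) y = e" by simp_all
    obtain i where i: "linked V E L (f(x := e, y := e)) i" "i x = e" "i y = e" "\<forall>u\<in>V - {x, y}. i u = h1 u"
      using rest[OF xy(1-4) g(1) gxy h1e] by blast
    have "i u \<noteq> e0" if "u \<in> V - {x, y}" for u using that h1 i(4) unfolding proper_col_def by auto
    then have j: "proper_col V E L (i(x := e0, y := e0))" "linked V E L i (i(x := e0, y := e0))"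
      using pair[OF linked_proper[OF i(1) g(1)] e0] by auto
    have jxy: "(i(x := e0, y := e0)) x = e0" "(i(x := e0, y := e0)) y = e0" by simp_all
    obtain l where l: "linked V E L (i(x := e0, y := e0)) l" "l x = e0" "l y = e0"
        "\<forall>u\<in>V - {x, y}. l u = h0 u"
      using rest[OF xy(1-4) j(1) jxy proper_col_mono[OF h0(2) order_refl h0(1)]] by blast
    have lc1: "linked V E L l c1"
      by (rule linked_eq[OF linked_proper[OF l(1) j(1)]]) (use l in \<open>auto simp: c1_def\<close>)
    note d also note f(1) also note g(2) also note i(1) also note j(2) also note l(1) also note lc1
    finally show ?thesis .
  qed
  show "linked V E L c0 d0"
    using rtranclp_trans[OF canon[OF c0] linked_sym[OF canon[OF d0]]] .
qed

subsection \<open>Structure of the graphs in the class\<close>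

text \<open>Distinctness is not stated in the patterns: for symmetric and irreflexive
  \<open>E\<close> the required edges and non-edges force it.\<close>

definition p5_free :: "'a set \<Rightarrow> ('a \<Rightarrow> 'a \<Rightarrow> bool) \<Rightarrow> bool" where
  "p5_free V E \<longleftrightarrow> (\<forall>a\<in>V. \<forall>b\<in>V. \<forall>c\<in>V. \<forall>d\<in>V. \<forall>e\<in>V.
    \<not> (E a b \<and> E b c \<and> E c d \<and> E d e \<and>
       \<not> E a c \<and> \<not> E a d \<and> \<not> E a e \<and> \<not> E b d \<and> \<not> E b e \<and> \<not> E c e))"

text \<open>The vertex \<open>a\<close> is the roof, \<open>b, c, e, d\<close> is the square.\<close>

definition house_free :: "'a set \<Rightarrow> ('a \<Rightarrow> 'a \<Rightarrow> bool) \<Rightarrow> bool" where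
  "house_free V E \<longleftrightarrow> (\<forall>a\<in>V. \<forall>b\<in>V. \<forall>c\<in>V. \<forall>d\<in>V. \<forall>e\<in>V.
    \<not> (E a b \<and> E a c \<and> E b c \<and> E b d \<and> E c e \<and> E d e \<and>
       \<not> E a d \<and> \<not> E a e \<and> \<not> E b e \<and> \<not> E c d))"

definition bull_free :: "'a set \<Rightarrow> ('a \<Rightarrow> 'a \<Rightarrow> bool) \<Rightarrow> bool" where
  "bull_free V E \<longleftrightarrow> (\<forall>a\<in>V. \<forall>b\<in>V. \<forall>c\<in>V. \<forall>d\<in>V. \<forall>e\<in>V.
    \<not> (E a b \<and> E a c \<and> E b c \<and> E d a \<and> E e b \<and>
       \<not> E d b \<and> \<not> E d c \<and> \<not> E d e \<and> \<not> E e a \<and> \<not> E e c))"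

definition induced_c5 :: "('a \<Rightarrow> 'a \<Rightarrow> bool) \<Rightarrow> 'a \<Rightarrow> 'a \<Rightarrow> 'a \<Rightarrow> 'a \<Rightarrow> 'a \<Rightarrow> bool" where
  "induced_c5 E a b c d e \<longleftrightarrow> E a b \<and> E b c \<and> E c d \<and> E d e \<and> E e a \<and>
    \<not> E a c \<and> \<not> E a d \<and> \<not> E b d \<and> \<not> E b e \<and> \<not> E c e"

definition c5_free :: "'a set \<Rightarrow> ('a \<Rightarrow> 'a \<Rightarrow> bool) \<Rightarrow> bool" where
  "c5_free V E \<longleftrightarrow> (\<forall>a\<in>V. \<forall>b\<in>V. \<forall>c\<in>V. \<forall>d\<in>V. \<forall>e\<in>V. \<not> induced_c5 E a b c d e)"

lemma p5_freeD:
  assumes "p5_free V E" "a \<in> V" "b \<in> V" "c \<in> V" "d \<in> V" "e \<in> V"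
  shows "\<not> (E a b \<and> E b c \<and> E c d \<and> E d e \<and>
       \<not> E a c \<and> \<not> E a d \<and> \<not> E a e \<and> \<not> E b d \<and> \<not> E b e \<and> \<not> E c e)"
  using assms unfolding p5_free_def by blast

lemma house_freeD:
  assumes "house_free V E" "a \<in> V" "b \<in> V" "c \<in> V" "d \<in> V" "e \<in> V"
  shows "\<not> (E a b \<and> E a c \<and> E b c \<and> E b d \<and> E c e \<and> E d e \<and>
       \<not> E a d \<and> \<not> E a e \<and> \<not> E b e \<and> \<not> E c d)"
  using assms unfolding house_free_def by blast

lemma bull_freeD:
  assumes "bull_free V E" "a \<in> V" "b \<in> V" "c \<in> V" "d \<in> V" "e \<in> V"
  shows "\<not> (E a b \<and> E a c \<and> E b c \<and> E d a \<and> E e b \<and>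
       \<not> E d b \<and> \<not> E d c \<and> \<not> E d e \<and> \<not> E e a \<and> \<not> E e c)"
  using assms unfolding bull_free_def by blast

lemma symp_clique_quotient: "symp E \<Longrightarrow> symp (clique_quotient K E)"
  unfolding clique_quotient_def by (auto intro!: sympI dest: sympD)

lemma irreflp_clique_quotient: "irreflp E \<Longrightarrow> irreflp (clique_quotient K E)"
  unfolding clique_quotient_def by (auto intro!: irreflpI dest: irreflpD)

section \<open>Graphs without an induced 5-cycle\<close>

text \<open>The other possibilities for \<open>s\<close> give forbidden graphs: adjacent to neither,
  the path \<open>s, v, t, c, d\<close>; to both, a house with roof \<open>d\<close>; only to
  \<open>d\<close>, the 5-cycle \<open>v, t, c, d, s\<close>.\<close>

lemma mixed_edge_transfer:
  assumes sym: "symp E" and "p5_free V E" "house_free V E" "c5_free V E"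
    and V: "v \<in> V" "s \<in> V" "t \<in> V" "c \<in> V" "d \<in> V"
    and "E v s" "E v t" "\<not> E s t" "\<not> E v c" "\<not> E v d" "E c d" "E t c" "\<not> E t d"
  shows "E s c \<and> \<not> E s d"
proof -
  have sym': "\<And>x y. E x y \<longleftrightarrow> E y x" using sym by (auto dest: sympD)
  note p5_freeD[OF assms(2), of s v t c d] house_freeD[OF assms(3), of d c s t v]
  moreover have "\<not> induced_c5 E v t c d s" using assms(4) V unfolding c5_free_def by blast
  ultimately show ?thesis
    using assms sym'[of s v] sym'[of t s] sym'[of s c] sym'[of s d] sym'[of d c] sym'[of t v]
      sym'[of t c] sym'[of t d] sym'[of v c] sym'[of v d]
    unfolding induced_c5_def by blast
qed

text \<open>Connectedness is phrased by cuts instead of paths, to suit arguments about subsets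
  closed under adjacency.\<close>

definition connected_set :: "('a \<Rightarrow> 'a \<Rightarrow> bool) \<Rightarrow> 'a set \<Rightarrow> bool" where
  "connected_set E C \<longleftrightarrow> C \<noteq> {} \<and> (\<forall>X. X \<subset> C \<longrightarrow> X \<noteq> {} \<longrightarrow> (\<exists>x\<in>X. \<exists>y\<in>C - X. E x y))"

lemma connected_set_insert:
  assumes "connected_set E C" "symp E" "c \<in> C" "E s c"
  shows "connected_set E (insert s C)"
  unfolding connected_set_def
proof (intro conjI allI impI)
  fix X assume X: "X \<subset> insert s C" "X \<noteq> {}"
  have Ecs: "E c s" using assms by (auto dest: sympD)
  consider "X \<inter> C = {}" | "C \<subseteq> X" | "X \<inter> C \<noteq> {}" "X \<inter> C \<subset> C" by blast
  then show "\<exists>x\<in>X. \<exists>y\<in>insert s C - X. E x y"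
  proof cases
    case 1
    then have "X = {s}" using X by auto
    then show ?thesis using 1 assms by blast
  next
    case 2
    then have "s \<notin> X" using X by blast
    then show ?thesis using 2 assms(3) Ecs by blast
  next
    case 3
    then obtain x y where "x \<in> X \<inter> C" "y \<in> C - X \<inter> C" "E x y"
      using assms(1) unfolding connected_set_def by meson
    then show ?thesis by blast
  qed
qed simp

text \<open>
  Take a vertex \<open>v\<close> and a connected set \<open>C\<close> without neighbors of \<open>v\<close>, with \<open>C\<close> as large as possible.
  Let \<open>S\<close> be the neighborhood of \<open>C\<close> and \<open>R\<close> the remaining vertices. Maximality makes \<open>R\<close> complete
  to \<open>S\<close>, so \<open>R\<close> is a module. Nonadjacent vertices of \<open>S\<close> have the same neighbors in \<open>C\<close>, hence
  the vertices of \<open>S\<close> with a given neighborhood in \<open>C\<close> form a module as well.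
\<close>

lemma simplicial_vertex_exists:
  assumes fin: "finite V" and ne: "V \<noteq> {}" and sym: "symp E" and irr: "irreflp E"
    and free: "p5_free V E" "house_free V E" "c5_free V E"
    and mods: "\<And>M. M \<subset> V \<Longrightarrow> is_module V E M \<Longrightarrow> clique M E"
  shows "\<exists>v\<in>V. clique {u\<in>V. E v u} E"
proof (cases "clique V E")
  case True
  then show ?thesis using ne unfolding clique_def by auto
next
  case False
  have sym': "\<And>x y. E x y \<Longrightarrow> E y x" using sym by (auto dest: sympD)
  have irr': "\<And>x. \<not> E x x" using irr by (auto dest: irreflpD)
  define ok where "ok = (\<lambda>(v, C). v \<in> V \<and> C \<subseteq> V - {v} \<and> connected_set E C \<and> (\<forall>c\<in>C. \<not> E v c))"
  obtain a b where "a \<in> V" "b \<in> V" "a \<noteq> b" "\<not> E a b" using False unfolding clique_def by blast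
  moreover have "connected_set E {b}" unfolding connected_set_def by auto
  ultimately have "ok (a, {b})" unfolding ok_def by auto
  moreover have "\<forall>p. ok p \<longrightarrow> card (snd p) < Suc (card V)"
  proof (intro allI impI)
    fix p assume "ok p"
    then have "snd p \<subseteq> V" unfolding ok_def by (auto split: prod.splits)
    then show "card (snd p) < Suc (card V)" using card_mono[OF fin] by (simp add: le_imp_less_Suc)
  qed
  ultimately obtain p where p: "ok p" "\<forall>q. ok q \<longrightarrow> card (snd q) \<le> card (snd p)"
    using ex_has_greatest_nat[of ok "(a, {b})" "card \<circ> snd" "Suc (card V)"] by auto
  obtain v C where "p = (v, C)" by (cases p)
  then have v: "v \<in> V" and C: "C \<subseteq> V - {v}" and con: "connected_set E C"
    and vC: "\<And>c. c \<in> C \<Longrightarrow> \<not> E v c"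
    and max: "\<And>v' C'. ok (v', C') \<Longrightarrow> card C' \<le> card C"
    using p unfolding ok_def by auto
  have Cne: "C \<noteq> {}" using con unfolding connected_set_def by auto
  have finC: "finite C" using C fin finite_subset by blast
  define S where "S = {s\<in>V - C. \<exists>c\<in>C. E s c}"
  define R where "R = V - C - S"
  have vR: "v \<in> R" using v C vC unfolding R_def S_def by auto
  have RC: "\<not> E r c" if "r \<in> R" "c \<in> C" for r c using that unfolding R_def S_def by auto
  \<comment> \<open>Otherwise \<open>r\<close> could replace \<open>v\<close>, with
    \<open>insert s C\<close> as a larger connected set.\<close>
  have RS: "E r s" if r: "r \<in> R" and s: "s \<in> S" for r s
  proof (rule ccontr)
    assume "\<not> E r s"
    obtain c where "c \<in> C" "E s c" using s unfolding S_def by auto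
    then have "connected_set E (insert s C)" using connected_set_insert[OF con sym] by auto
    moreover have "r \<in> V" "r \<notin> C" "r \<noteq> s" "s \<in> V" using r s unfolding R_def S_def by auto
    moreover have "\<forall>c\<in>insert s C. \<not> E r c" using RC[OF r] \<open>\<not> E r s\<close> by blast
    ultimately have "ok (r, insert s C)" using C unfolding ok_def by blast
    then have "card (insert s C) \<le> card C" by (rule max)
    then show False using s finC unfolding S_def by auto
  qed
  have "is_module V E R"
    unfolding is_module_def
  proof (intro conjI ballI)
    fix z x y assume z: "z \<in> V - R" and xy: "x \<in> R" "y \<in> R"
    show "E z x \<longleftrightarrow> E z y"
    proof (cases "z \<in> C")
      case True
      then show ?thesis using RC xy sym' by blast
    next
      case False
      then have "z \<in> S" using z unfolding R_def by auto
      then show ?thesis using RS xy sym' by blast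
    qed
  qed (auto simp: R_def)
  moreover have "R \<subset> V" using Cne C unfolding R_def by blast
  ultimately have Rcl: "clique R E" using mods by auto
  have same: "E s c \<longleftrightarrow> E t c" if s: "s \<in> S" and t: "t \<in> S" and st: "\<not> E s t" and c: "c \<in> C" for s t c
  proof -
    have tr: "E s' c \<and> \<not> E s' d"
      if "s' \<in> S" "t' \<in> S" "\<not> E s' t'" "c \<in> C" "d \<in> C" "E c d" "E t' c" "\<not> E t' d" for s' t' c d
      using mixed_edge_transfer[OF sym free, of v s' t' c d] that v C vC RS[OF vR] unfolding S_def by blast
    have ts: "\<not> E t s" using st sym' by blast
    \<comment> \<open>The part of \<open>C\<close> on which \<open>s\<close> and \<open>t\<close>
      agree. By \<open>tr\<close>, an edge of \<open>C\<close> with just one end adjacent to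
      \<open>s\<close> or to \<open>t\<close> is seen alike by both, so no edge leaves
      \<open>X\<close>.\<close>
    define X where "X = {c\<in>C. E s c \<longleftrightarrow> E t c}"
    have closed: "y \<in> X" if "x \<in> X" "y \<in> C" "E x y" for x y
      using tr[OF s t st, of x y] tr[OF t s ts, of x y] tr[OF s t st, of y x] tr[OF t s ts, of y x]
        that sym'[OF that(3)] unfolding X_def by blast
    \<comment> \<open>With no agreement at all, a neighbor of \<open>s\<close> in \<open>C\<close>
      is a non-neighbor of \<open>t\<close>, so some edge of \<open>C\<close> has exactly one end
      adjacent to \<open>t\<close>; by \<open>tr\<close> that end is adjacent to \<open>s\<close>
      too.\<close>
    have "X \<noteq> {}"
    proof
      assume X: "X = {}"
      obtain x where x: "x \<in> C" "E t x" using t unfolding S_def by blast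
      have "{c\<in>C. E t c} \<subset> C"
      proof -
        obtain y where "y \<in> C" "E s y" using s unfolding S_def by blast
        then have "\<not> E t y" using X unfolding X_def by auto
        then show ?thesis using \<open>y \<in> C\<close> by blast
      qed
      then obtain c d where "c \<in> C" "E t c" "d \<in> C" "\<not> E t d" "E c d"
        using con x unfolding connected_set_def by blast
      then have "c \<in> X" using tr[OF s t st, of c d] unfolding X_def by auto
      then show False using X by auto
    qed
    then have "X = C" using closed con unfolding connected_set_def
      by (metis (no_types, lifting) Diff_iff X_def mem_Collect_eq psubsetI subsetI)
    then show ?thesis using c unfolding X_def by auto
  qed
  have "clique S E"
    unfolding clique_def
  proof (intro ballI impI, rule ccontr)
    fix s s' assume s: "s \<in> S" "s' \<in> S" "s \<noteq> s'" "\<not> E s s'"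
    define T where "T = {t\<in>S. \<forall>c\<in>C. E t c \<longleftrightarrow> E s c}"
    have "is_module V E T"
      unfolding is_module_def
    proof (intro conjI ballI)
      fix z x y assume z: "z \<in> V - T" and xy: "x \<in> T" "y \<in> T"
      then have xyS: "x \<in> S" "y \<in> S" unfolding T_def by auto
      consider "z \<in> C" | "z \<in> R" | "z \<in> S" using z unfolding R_def by auto
      then show "E z x \<longleftrightarrow> E z y"
      proof cases
        case 1
        then show ?thesis using xy sym' unfolding T_def by blast
      next
        case 2
        then show ?thesis using RS xyS by blast
      next
        case 3
        \<comment> \<open>A vertex of \<open>S\<close> outside \<open>T\<close> sees
          \<open>C\<close> differently, so \<open>same\<close> forces it to be adjacent to
          \<open>w\<close>.\<close>
        then have "E z w" if "w \<in> T" for w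
          using same[of z w] that z unfolding T_def by blast
        then show ?thesis using xy by blast
      qed
    qed (auto simp: T_def S_def)
    moreover have "T \<subset> V" using vR v unfolding T_def S_def R_def by blast
    ultimately have "clique T E" using mods by auto
    moreover have "s \<in> T" "s' \<in> T" using s same[of s s'] unfolding T_def by auto
    ultimately show False using s unfolding clique_def by auto
  qed
  have "clique {u\<in>V. E v u} E"
    unfolding clique_def
  proof (intro ballI impI)
    fix x y assume "x \<in> {u\<in>V. E v u}" "y \<in> {u\<in>V. E v u}" "x \<noteq> y"
    then have "x \<in> R \<union> S" "y \<in> R \<union> S" using vC unfolding R_def by auto
    then show "E x y" using Rcl \<open>clique S E\<close> RS sym' \<open>x \<noteq> y\<close> unfolding clique_def by blast
  qed
  then show ?thesis using v by auto
qed

text \<open>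
  None of the three forbidden graphs has a nontrivial module, so an induced copy of one of them in
  the quotient meets the clique in at most one vertex.
\<close>

lemma clique_quotient_separated:
  assumes "symp E" "is_module V E M" "K \<subseteq> M" "z \<in> V - M \<union> K"
    and "clique_quotient K E z x" "\<not> clique_quotient K E z y" "z \<noteq> y" "x \<in> K" "y \<in> K"
  shows False
proof (cases "z \<in> K")
  case True
  then show ?thesis using assms unfolding clique_quotient_def by auto
next
  case False
  then have "E z x \<longleftrightarrow> E z y" using assms(2-4,8,9) unfolding is_module_def by blast
  then show ?thesis using False assms unfolding clique_quotient_def by auto
qed

lemma clique_quotient_outside:
  "\<not> (x \<in> K \<and> y \<in> K) \<Longrightarrow> clique_quotient K E x y \<longleftrightarrow> E x y"
  unfolding clique_quotient_def by auto

lemma p5_free_clique_quotient: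
  assumes free: "p5_free V E" and sym: "symp E" and irr: "irreflp E"
    and mod: "is_module V E M" and K: "K \<subseteq> M"
  shows "p5_free (V - M \<union> K) (clique_quotient K E)"
  unfolding p5_free_def
proof (intro ballI notI)
  let ?Q = "clique_quotient K E"
  fix a b c d e
  assume V: "a \<in> V - M \<union> K" "b \<in> V - M \<union> K" "c \<in> V - M \<union> K" "d \<in> V - M \<union> K" "e \<in> V - M \<union> K"
  then have V': "a \<in> V" "b \<in> V" "c \<in> V" "d \<in> V" "e \<in> V"
    using mod K unfolding is_module_def by auto
  assume "?Q a b \<and> ?Q b c \<and> ?Q c d \<and> ?Q d e \<and>
    \<not> ?Q a c \<and> \<not> ?Q a d \<and> \<not> ?Q a e \<and> \<not> ?Q b d \<and> \<not> ?Q b e \<and> \<not> ?Q c e"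
  then have adj: "?Q a b" "?Q b c" "?Q c d" "?Q d e"
    and nonadj: "\<not> ?Q a c" "\<not> ?Q a d" "\<not> ?Q a e" "\<not> ?Q b d" "\<not> ?Q b e" "\<not> ?Q c e"
    by blast+
  have sym': "\<And>x y. ?Q x y \<Longrightarrow> ?Q y x" using symp_clique_quotient[OF sym] by (meson sympD)
  have irr': "\<And>x. \<not> ?Q x x" using irreflp_clique_quotient[OF irr] by (meson irreflpD)
  have ne: "a \<noteq> b" "a \<noteq> c" "a \<noteq> d" "a \<noteq> e" "b \<noteq> c" "b \<noteq> d" "b \<noteq> e" "c \<noteq> d" "c \<noteq> e" "d \<noteq> e"
    using adj nonadj sym' irr' by metis+
  note sep = clique_quotient_separated[OF sym mod K]
  have one: "\<not> (a \<in> K \<and> b \<in> K)"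
    "\<not> (a \<in> K \<and> c \<in> K)"
    "\<not> (a \<in> K \<and> d \<in> K)"
    "\<not> (a \<in> K \<and> e \<in> K)"
    "\<not> (b \<in> K \<and> c \<in> K)"
    "\<not> (b \<in> K \<and> d \<in> K)"
    "\<not> (b \<in> K \<and> e \<in> K)"
    "\<not> (c \<in> K \<and> d \<in> K)"
    "\<not> (c \<in> K \<and> e \<in> K)"
    "\<not> (d \<in> K \<and> e \<in> K)"
    \<comment> \<open>For each pair a third vertex of the path is chosen that is adjacent to the
      first listed vertex and not to the second.\<close>
    using sep[OF V(3), of b a]
      sep[OF V(4), of c a]
      sep[OF V(2), of a d]
      sep[OF V(2), of a e]
      sep[OF V(1), of b c]
      sep[OF V(1), of b d]
      sep[OF V(1), of b e]
      sep[OF V(2), of c d]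
      sep[OF V(2), of c e]
      sep[OF V(3), of d e]
      adj nonadj ne sym' by metis+
  show False
    using p5_freeD[OF free V'] adj nonadj one by (simp add: clique_quotient_outside conj_commute)
qed

lemma house_free_clique_quotient:
  assumes free: "house_free V E" and sym: "symp E" and irr: "irreflp E"
    and mod: "is_module V E M" and K: "K \<subseteq> M"
  shows "house_free (V - M \<union> K) (clique_quotient K E)"
  unfolding house_free_def
proof (intro ballI notI)
  let ?Q = "clique_quotient K E"
  fix a b c d e
  assume V: "a \<in> V - M \<union> K" "b \<in> V - M \<union> K" "c \<in> V - M \<union> K" "d \<in> V - M \<union> K" "e \<in> V - M \<union> K"
  then have V': "a \<in> V" "b \<in> V" "c \<in> V" "d \<in> V" "e \<in> V"
    using mod K unfolding is_module_def by auto
  assume "?Q a b \<and> ?Q a c \<and> ?Q b c \<and> ?Q b d \<and> ?Q c e \<and> ?Q d e \<and>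
    \<not> ?Q a d \<and> \<not> ?Q a e \<and> \<not> ?Q b e \<and> \<not> ?Q c d"
  then have adj: "?Q a b" "?Q a c" "?Q b c" "?Q b d" "?Q c e" "?Q d e"
    and nonadj: "\<not> ?Q a d" "\<not> ?Q a e" "\<not> ?Q b e" "\<not> ?Q c d"
    by blast+
  have sym': "\<And>x y. ?Q x y \<Longrightarrow> ?Q y x" using symp_clique_quotient[OF sym] by (meson sympD)
  have irr': "\<And>x. \<not> ?Q x x" using irreflp_clique_quotient[OF irr] by (meson irreflpD)
  have ne: "a \<noteq> b" "a \<noteq> c" "a \<noteq> d" "a \<noteq> e" "b \<noteq> c" "b \<noteq> d" "b \<noteq> e" "c \<noteq> d" "c \<noteq> e" "d \<noteq> e"
    using adj nonadj sym' irr' by metis+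
  note sep = clique_quotient_separated[OF sym mod K]
  have one: "\<not> (a \<in> K \<and> b \<in> K)"
    "\<not> (a \<in> K \<and> c \<in> K)"
    "\<not> (a \<in> K \<and> d \<in> K)"
    "\<not> (a \<in> K \<and> e \<in> K)"
    "\<not> (b \<in> K \<and> c \<in> K)"
    "\<not> (b \<in> K \<and> d \<in> K)"
    "\<not> (b \<in> K \<and> e \<in> K)"
    "\<not> (c \<in> K \<and> d \<in> K)"
    "\<not> (c \<in> K \<and> e \<in> K)"
    "\<not> (d \<in> K \<and> e \<in> K)"
    using sep[OF V(4), of b a]
      sep[OF V(5), of c a]
      sep[OF V(3), of a d]
      sep[OF V(2), of a e]
      sep[OF V(4), of b c]
      sep[OF V(1), of b d]
      sep[OF V(1), of b e]
      sep[OF V(1), of c d]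
      sep[OF V(1), of c e]
      sep[OF V(2), of d e]
      adj nonadj ne sym' by metis+
  show False
    using house_freeD[OF free V'] adj nonadj one by (simp add: clique_quotient_outside conj_commute)
qed

lemma bull_free_clique_quotient:
  assumes free: "bull_free V E" and sym: "symp E" and irr: "irreflp E"
    and mod: "is_module V E M" and K: "K \<subseteq> M"
  shows "bull_free (V - M \<union> K) (clique_quotient K E)"
  unfolding bull_free_def
proof (intro ballI notI)
  let ?Q = "clique_quotient K E"
  fix a b c d e
  assume V: "a \<in> V - M \<union> K" "b \<in> V - M \<union> K" "c \<in> V - M \<union> K" "d \<in> V - M \<union> K" "e \<in> V - M \<union> K"
  then have V': "a \<in> V" "b \<in> V" "c \<in> V" "d \<in> V" "e \<in> V"
    using mod K unfolding is_module_def by auto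
  assume "?Q a b \<and> ?Q a c \<and> ?Q b c \<and> ?Q d a \<and> ?Q e b \<and>
    \<not> ?Q d b \<and> \<not> ?Q d c \<and> \<not> ?Q d e \<and> \<not> ?Q e a \<and> \<not> ?Q e c"
  then have adj: "?Q a b" "?Q a c" "?Q b c" "?Q d a" "?Q e b"
    and nonadj: "\<not> ?Q d b" "\<not> ?Q d c" "\<not> ?Q d e" "\<not> ?Q e a" "\<not> ?Q e c"
    by blast+
  have sym': "\<And>x y. ?Q x y \<Longrightarrow> ?Q y x" using symp_clique_quotient[OF sym] by (meson sympD)
  have irr': "\<And>x. \<not> ?Q x x" using irreflp_clique_quotient[OF irr] by (meson irreflpD)
  have ne: "a \<noteq> b" "a \<noteq> c" "a \<noteq> d" "a \<noteq> e" "b \<noteq> c" "b \<noteq> d" "b \<noteq> e" "c \<noteq> d" "c \<noteq> e" "d \<noteq> e"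
    using adj nonadj sym' irr' by metis+
  note sep = clique_quotient_separated[OF sym mod K]
  have one: "\<not> (a \<in> K \<and> b \<in> K)"
    "\<not> (a \<in> K \<and> c \<in> K)"
    "\<not> (a \<in> K \<and> d \<in> K)"
    "\<not> (a \<in> K \<and> e \<in> K)"
    "\<not> (b \<in> K \<and> c \<in> K)"
    "\<not> (b \<in> K \<and> d \<in> K)"
    "\<not> (b \<in> K \<and> e \<in> K)"
    "\<not> (c \<in> K \<and> d \<in> K)"
    "\<not> (c \<in> K \<and> e \<in> K)"
    "\<not> (d \<in> K \<and> e \<in> K)"
    using sep[OF V(4), of a b]
      sep[OF V(4), of a c]
      sep[OF V(2), of a d]
      sep[OF V(3), of a e]
      sep[OF V(5), of b c]
      sep[OF V(3), of b d]
      sep[OF V(1), of b e]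
      sep[OF V(2), of c d]
      sep[OF V(1), of c e]
      sep[OF V(1), of d e]
      adj nonadj ne sym' by metis+
  show False
    using bull_freeD[OF free V'] adj nonadj one by (simp add: clique_quotient_outside conj_commute)
qed

text \<open>
  The vertices that can replace \<open>a\<close> in the induced 5-cycle \<open>a, b, c, d, e\<close>; they may or may not be
  adjacent to \<open>a\<close>.
\<close>

definition c5_part :: "('a \<Rightarrow> 'a \<Rightarrow> bool) \<Rightarrow> 'a \<Rightarrow> 'a \<Rightarrow> 'a \<Rightarrow> 'a \<Rightarrow> 'a \<Rightarrow> bool" where
  "c5_part E b c d e w \<longleftrightarrow> E w b \<and> E w e \<and> \<not> E w c \<and> \<not> E w d"

section \<open>Vertices around an induced 5-cycle\<close>

lemma induced_c5_rotate: "symp E \<Longrightarrow> induced_c5 E a b c d e \<Longrightarrow> induced_c5 E b c d e a"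
  unfolding induced_c5_def by (auto dest: sympD)

text \<open>Up to rotation four neighborhoods on the cycle must be excluded: a single vertex gives a
  P5, two consecutive vertices a bull, two consecutive vertices with the opposite one a house, and
  four vertices a house.\<close>

lemma c5_vertex_types:
  assumes sym: "symp E" and irr: "irreflp E" and free: "p5_free V E" "house_free V E" "bull_free V E"
    and c5: "induced_c5 E a b c d e"
    and V: "a \<in> V" "b \<in> V" "c \<in> V" "d \<in> V" "e \<in> V" and w: "w \<in> V"
  shows "E w a \<and> E w b \<and> E w c \<and> E w d \<and> E w e \<or>
    \<not> E w a \<and> \<not> E w b \<and> \<not> E w c \<and> \<not> E w d \<and> \<not> E w e \<or>
    c5_part E b c d e w \<or> c5_part E c d e a w \<or> c5_part E d e a b w \<or> c5_part E e a b c w \<or>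
    c5_part E a b c d w"
proof -
  have sym': "\<And>x y. E x y \<longleftrightarrow> E y x" using sym by (auto dest: sympD)
  have local: "\<not> (E w a \<and> \<not> E w b \<and> \<not> E w c \<and> \<not> E w d \<and> \<not> E w e) \<and>
      \<not> (E w a \<and> E w b \<and> \<not> E w c \<and> \<not> E w d \<and> \<not> E w e) \<and>
      \<not> (E w a \<and> E w b \<and> E w d \<and> \<not> E w c \<and> \<not> E w e) \<and>
      \<not> (E w a \<and> E w b \<and> E w c \<and> E w d \<and> \<not> E w e)"
    if "induced_c5 E a b c d e" and V: "a \<in> V" "b \<in> V" "c \<in> V" "d \<in> V" "e \<in> V" for a b c d e
    using that(1) p5_freeD[OF free(1) w V(1-4)] bull_freeD[OF free(3) V(1,2) w V(5,3)]
      house_freeD[OF free(2) V(1) w V(2,4,3)] house_freeD[OF free(2) V(2) w V(1,4,5)]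
    unfolding induced_c5_def
    by (simp add: sym'[of w] sym'[of b a] sym'[of c b] sym'[of d c] sym'[of e d] sym'[of a e]
        sym'[of c a] sym'[of d a] sym'[of d b] sym'[of e b] sym'[of e c]) blast
  note r1 = induced_c5_rotate[OF sym c5]
  note r2 = induced_c5_rotate[OF sym r1]
  note r3 = induced_c5_rotate[OF sym r2]
  note r4 = induced_c5_rotate[OF sym r3]
  show ?thesis
    using local[OF c5 V] local[OF r1 V(2-5,1)] local[OF r2 V(3-5,1,2)] local[OF r3 V(4,5,1-3)]
      local[OF r4 V(5,1-4)]
    unfolding c5_part_def
    by (cases "E w a"; cases "E w b"; cases "E w c"; cases "E w d"; cases "E w e"; simp)
qed

text \<open>Replacing \<open>a\<close> by \<open>x\<close> gives another induced 5-cycle. The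
  adjacency of \<open>y\<close> to \<open>b\<close>, \<open>c\<close>, \<open>d\<close>,
  \<open>e\<close> leaves only one type of \<open>y\<close> for this cycle up to what is claimed,
  which decides whether \<open>y\<close> is adjacent to \<open>x\<close>.\<close>

lemma c5_parts_adjacency:
  assumes sym: "symp E" and irr: "irreflp E" and free: "p5_free V E" "house_free V E" "bull_free V E"
    and c5: "induced_c5 E a b c d e"
    and V: "a \<in> V" "b \<in> V" "c \<in> V" "d \<in> V" "e \<in> V"
    and x: "x \<in> V" "c5_part E b c d e x" and y: "y \<in> V"
  shows "c5_part E c d e a y \<Longrightarrow> E x y" "c5_part E d e a b y \<Longrightarrow> \<not> E x y"
    "E y a \<and> E y b \<and> E y c \<and> E y d \<and> E y e \<Longrightarrow> E y x"
    "\<not> E y a \<and> \<not> E y b \<and> \<not> E y c \<and> \<not> E y d \<and> \<not> E y e \<Longrightarrow> \<not> E y x"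
proof -
  have sym': "\<And>x y. E x y \<longleftrightarrow> E y x" using sym by (auto dest: sympD)
  have "induced_c5 E x b c d e"
    using c5 x(2) sym'[of x e] unfolding induced_c5_def c5_part_def by auto
  note t = c5_vertex_types[OF sym irr free this x(1) V(2-5) y]
  show "c5_part E c d e a y \<Longrightarrow> E x y" "c5_part E d e a b y \<Longrightarrow> \<not> E x y"
    "E y a \<and> E y b \<and> E y c \<and> E y d \<and> E y e \<Longrightarrow> E y x"
    "\<not> E y a \<and> \<not> E y b \<and> \<not> E y c \<and> \<not> E y d \<and> \<not> E y e \<Longrightarrow> \<not> E y x"
    using t sym'[of x y] unfolding c5_part_def by auto
qed

lemma c5_blowup_exists:
  assumes sym: "symp E" and irr: "irreflp E" and free: "p5_free V E" "house_free V E" "bull_free V E"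
    and c5: "induced_c5 E a b c d e"
    and V: "a \<in> V" "b \<in> V" "c \<in> V" "d \<in> V" "e \<in> V"
    and mods: "\<And>M. M \<subset> V \<Longrightarrow> is_module V E M \<Longrightarrow> clique M E"
  shows "\<exists>t. c5_blowup V E t"
proof -
  have sym': "\<And>x y. E x y \<Longrightarrow> E y x" using sym by (auto dest: sympD)
  have irr': "\<And>x. \<not> E x x" using irr by (auto dest: irreflpD)
  note r1 = induced_c5_rotate[OF sym c5]
  note r2 = induced_c5_rotate[OF sym r1]
  note r3 = induced_c5_rotate[OF sym r2]
  note r4 = induced_c5_rotate[OF sym r3]
  note adj0 = c5_parts_adjacency[OF sym irr free c5 V]
  note adj1 = c5_parts_adjacency[OF sym irr free r1 V(2-5,1)]
  note adj2 = c5_parts_adjacency[OF sym irr free r2 V(3-5,1,2)]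
  note adj3 = c5_parts_adjacency[OF sym irr free r3 V(4,5,1-3)]
  note adj4 = c5_parts_adjacency[OF sym irr free r4 V(5,1-4)]
  define P where "P i = {w\<in>V. (if i = 0 then c5_part E b c d e w else if i = 1 then c5_part E c d e a w
    else if i = 2 then c5_part E d e a b w else if i = 3 then c5_part E e a b c w
    else c5_part E a b c d w)}" for i :: nat
  have P: "P 0 = {w\<in>V. c5_part E b c d e w}" "P (Suc 0) = {w\<in>V. c5_part E c d e a w}"
    "P 2 = {w\<in>V. c5_part E d e a b w}" "P 3 = {w\<in>V. c5_part E e a b c w}"
    "P 4 = {w\<in>V. c5_part E a b c d w}" "P (Suc (Suc 0)) = {w\<in>V. c5_part E d e a b w}"
    unfolding P_def by simp_all
  have mem: "a \<in> P 0" "b \<in> P (Suc 0)" "c \<in> P 2" "d \<in> P 3" "e \<in> P 4"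
    using V c5 irr' sym' unfolding P c5_part_def induced_c5_def by blast+
  have complete: "E x y" if "i < 5" "x \<in> P i" "y \<in> P (Suc i mod 5)" for i x y
    using less5_cases[OF that(1)] that adj0(1) adj1(1) adj2(1) adj3(1) adj4(1) by (auto simp: P)
  have anti: "\<not> E x y" if "i < 5" "x \<in> P i" "y \<in> P ((i + 2) mod 5)" for i x y
    using less5_cases[OF that(1)] that adj0(2) adj1(2) adj2(2) adj3(2) adj4(2) by (auto simp: P)
  have outside: "E z x \<longleftrightarrow> E z y"
    if z: "z \<in> V" "\<And>i. i < 5 \<Longrightarrow> z \<notin> P i" and xy: "i < 5" "j < 5" "x \<in> P i" "y \<in> P j" for z x y i j
  proof -
    have "z \<notin> P 0" "z \<notin> P (Suc 0)" "z \<notin> P 2" "z \<notin> P 3" "z \<notin> P 4" using z(2) by auto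
    then consider "E z a \<and> E z b \<and> E z c \<and> E z d \<and> E z e"
      | "\<not> E z a \<and> \<not> E z b \<and> \<not> E z c \<and> \<not> E z d \<and> \<not> E z e"
      using c5_vertex_types[OF sym irr free c5 V z(1)] z(1) unfolding P by blast
    then show ?thesis
    proof cases
      case 1
      have "E z x" if "i < 5" "x \<in> P i" for i x
        using less5_cases[OF that(1)] that(2) 1 z(1) adj0(3) adj1(3) adj2(3) adj3(3) adj4(3) by (auto simp: P)
      then show ?thesis using xy by blast
    next
      case 2
      have "\<not> E z x" if "i < 5" "x \<in> P i" for i x
        using less5_cases[OF that(1)] that(2) 2 z(1) adj0(4) adj1(4) adj2(4) adj3(4) adj4(4) by (auto simp: P)
      then show ?thesis using xy by blast
    qed
  qed
  define U where "U = (\<Union>i<5. P i)"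
  have PV: "P i \<subseteq> V" for i unfolding P_def by auto
  have "is_module V E U"
    unfolding is_module_def
  proof (intro conjI ballI)
    show "U \<subseteq> V" using PV unfolding U_def by auto
    fix z x y assume "z \<in> V - U" "x \<in> U" "y \<in> U"
    then show "E z x \<longleftrightarrow> E z y" using outside[of z _ _ x y] unfolding U_def by blast
  qed
  moreover have "\<not> clique U E"
  proof -
    have "a \<in> U" "c \<in> U" using mem unfolding U_def by force+
    moreover have "a \<noteq> c" "\<not> E a c" using c5 sym' unfolding induced_c5_def by blast+
    ultimately show ?thesis unfolding clique_def by blast
  qed
  ultimately have "U = V" using mods[of U] unfolding is_module_def by blast
  then have "\<forall>x\<in>V. \<exists>i. i < 5 \<and> x \<in> P i" unfolding U_def by auto
  then obtain t where t: "\<And>x. x \<in> V \<Longrightarrow> t x < 5" "\<And>x. x \<in> V \<Longrightarrow> x \<in> P (t x)" by metis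
  have adj: "E x y \<longleftrightarrow> near5 i j" if "i < 5" "j < 5" "i \<noteq> j" "x \<in> P i" "y \<in> P j" for x y i j
  proof (cases "near5 i j")
    case True
    then show ?thesis using complete[of i x y] complete[of j y x] sym' that unfolding near5_def by blast
  next
    case False
    then have "j = (i + 2) mod 5 \<or> i = (j + 2) mod 5"
      using less5_cases[OF that(1)] less5_cases[OF that(2)] by (auto simp: near5_def)
    then show ?thesis using False anti[of i x y] anti[of j y x] sym' that by blast
  qed
  have disj: "i = j" if ij: "i < 5" "j < 5" and x: "x \<in> P i" "x \<in> P j" for x i j
    using less5_cases[OF ij(1)] less5_cases[OF ij(2)] x by (elim disjE) (auto simp: P c5_part_def)
  have rep: "\<exists>x. x \<in> P i" if "i < 5" for i
    using less5_cases[OF that] mem by auto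
  \<comment> \<open>Adjacency between different parts depends on the indices alone, so every part is
    a proper module, and the hypothesis on modules settles adjacency within it.\<close>
  have cl: "clique (P i) E" if i: "i < 5" for i
  proof (rule mods)
    have "Suc i mod 5 < 5" "Suc i mod 5 \<noteq> i" using less5_cases[OF i] by auto
    then obtain x where "x \<in> P (Suc i mod 5)" "x \<notin> P i" using rep disj i by blast
    then show "P i \<subset> V" using PV by blast
    show "is_module V E (P i)"
      unfolding is_module_def
    proof (intro conjI ballI PV)
      fix z x y assume z: "z \<in> V - P i" and xy: "x \<in> P i" "y \<in> P i"
      then have "t z \<noteq> i" using t by auto
      then show "E z x \<longleftrightarrow> E z y" using adj[of "t z" i z] t z xy i by blast
    qed
  qed
  have "t ` V = {..<5}"
  proof
    show "{..<5} \<subseteq> t ` V"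
    proof
      fix i :: nat assume "i \<in> {..<5}"
      then have i: "i < 5" by simp
      then obtain x where x: "x \<in> P i" using rep by blast
      then have "x \<in> V" using PV by blast
      then show "i \<in> t ` V" using disj[OF i _ x] t by blast
    qed
  qed (use t in auto)
  moreover have "E x y \<longleftrightarrow> x \<noteq> y \<and> near5 (t x) (t y)" if "x \<in> V" "y \<in> V" for x y
  proof (cases "t x = t y")
    case True
    then have "y \<in> P (t x)" using t that by metis
    then show ?thesis using cl[OF t(1)[OF that(1)]] t(2)[OF that(1)] True irr'
      unfolding clique_def near5_def by auto
  next
    case False
    then show ?thesis using adj[of "t x" "t y" x y] t that by blast
  qed
  ultimately show ?thesis unfolding c5_blowup_def by blast
qed

text \<open>The induction on the number of vertices also generalizes \<open>E\<close>, because the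
  quotient by a module has a different adjacency relation.\<close>

lemma always_mixing_p5_house_bull_free:
  assumes "finite V" "symp E" "irreflp E" "p5_free V E" "house_free V E" "bull_free V E"
  shows "always_mixing V E"
  using assms
proof (induction "card V" arbitrary: V E rule: less_induct)
  case less
  note fin = less.prems(1) and sym = less.prems(2) and irr = less.prems(3) and free = less.prems(4-6)
  have sub: "always_mixing W E" if "W \<subset> V" for W
  proof (rule less.hyps)
    show "card W < card V" using psubset_card_mono[OF fin that] .
    show "finite W" using that fin finite_subset by blast
    show "p5_free W E" "house_free W E" "bull_free W E"
      using free that unfolding p5_free_def house_free_def bull_free_def by (meson psubsetD)+
  qed (use sym irr in auto)
  show ?case
  proof (cases "\<exists>M. M \<subset> V \<and> is_module V E M \<and> \<not> clique M E")
    case True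
    then obtain M where M: "M \<subset> V" "is_module V E M" "\<not> clique M E" by blast
    show ?thesis
    proof (rule always_mixing_module[OF fin sym irr M(2,3) sub[OF M(1)]])
      fix K assume K: "K \<subset> M"
      then have KM: "K \<subseteq> M" by auto
      \<comment> \<open>Strictness of \<open>K \<subset> M\<close> makes the quotient smaller than
        the graph.\<close>
      have "V - M \<union> K \<subset> V" using K M(1) by auto
      then have "card (V - M \<union> K) < card V" "finite (V - M \<union> K)"
        using psubset_card_mono[OF fin] finite_subset[OF _ fin] by auto
      then show "always_mixing (V - M \<union> K) (clique_quotient K E)"
        by (intro less.hyps symp_clique_quotient irreflp_clique_quotient
            p5_free_clique_quotient[OF free(1) sym irr M(2) KM]
            house_free_clique_quotient[OF free(2) sym irr M(2) KM]
            bull_free_clique_quotient[OF free(3) sym irr M(2) KM] sym irr)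
    qed
  next
    case False
    then have mods: "\<And>M. M \<subset> V \<Longrightarrow> is_module V E M \<Longrightarrow> clique M E" by blast
    show ?thesis
    proof (cases "c5_free V E")
      case True
      show ?thesis
      proof (cases "V = {}")
        case True
        then show ?thesis unfolding always_mixing_def mixing_def by (auto intro: linked_eq)
      next
        case False
        then obtain v where v: "v \<in> V" "clique {u\<in>V. E v u} E"
          using simplicial_vertex_exists[OF fin _ sym irr free(1,2) \<open>c5_free V E\<close> mods] by blast
        have "V - {v} \<subset> V" using v by blast
        then show ?thesis using always_mixing_simplicial[OF fin sym irr v] sub by blast
      qed
    next
      case False
      then obtain a b c d e where V: "a \<in> V" "b \<in> V" "c \<in> V" "d \<in> V" "e \<in> V"
        and c5: "induced_c5 E a b c d e" unfolding c5_free_def by blast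
      obtain t where "c5_blowup V E t" using c5_blowup_exists[OF sym irr free c5 V mods] by blast
      then show ?thesis using always_mixing_c5_blowup[OF fin sym irr _ sub] by blast
    qed
  qed
qed

subsection \<open>Transfer to the graph library\<close>

lemma proper_col_restrict: "proper_col V E L (restrict c V) \<longleftrightarrow> proper_col V E L c"
  by (rule proper_col_cong) simp

lemma colorings_iff:
  assumes "pair_graph G"
  shows "c \<in> colorings G k \<longleftrightarrow>
    c \<in> extensional (pverts G) \<and> proper_col (pverts G) (\<lambda>u v. (u, v) \<in> parcs G) {1..k} c"
proof -
  interpret pair_graph G by fact
  show ?thesis
    unfolding colorings_def proper_col_def PiE_def Pi_def by (auto dest: in_arcsD1 in_arcsD2)
qed

text \<open>A \<open>recol\<close> step may change nothing on the vertices; such a step collapses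
  under \<open>restrict\<close>. Reachability refers to the symmetric closure since the library
  defines \<open>connected\<close> through it.\<close>

lemma linked_imp_reachable:
  assumes G: "pair_graph G" and c: "proper_col (pverts G) (\<lambda>u v. (u, v) \<in> parcs G) {1..k} c"
    and "linked (pverts G) (\<lambda>u v. (u, v) \<in> parcs G) {1..k} c d"
  shows "restrict c (pverts G) \<rightarrow>\<^sup>*\<^bsub>with_proj (mk_symmetric (with_proj (recoloring_graph k G)))\<^esub> restrict d (pverts G)"
  using assms(3)
proof (induction rule: rtranclp_induct)
  case base
  have "restrict c (pverts G) \<in> colorings G k"
    using c unfolding colorings_iff[OF G] proper_col_restrict by auto
  then show ?case unfolding reachable_def by (auto simp: recoloring_graph_def)
next
  case (step d e)
  let ?d = "restrict d (pverts G)" and ?e = "restrict e (pverts G)"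
  from step(2) obtain v where v: "\<forall>u\<in>pverts G - {v}. d u = e u"
    and "proper_col (pverts G) (\<lambda>u v. (u, v) \<in> parcs G) {1..k} d"
    and "proper_col (pverts G) (\<lambda>u v. (u, v) \<in> parcs G) {1..k} e"
    unfolding recol_def by auto
  then have de: "?d \<in> colorings G k" "?e \<in> colorings G k"
    unfolding colorings_iff[OF G] proper_col_restrict by auto
  show ?case
  proof (cases "?d = ?e")
    case True
    then show ?thesis using step.IH by simp
  next
    case False
    then obtain w where w: "?d w \<noteq> ?e w" by (auto simp: fun_eq_iff)
    then have "w \<in> pverts G" by (auto simp: restrict_def split: if_splits)
    have only: "u = v" if "u \<in> pverts G" "?d u \<noteq> ?e u" for u using v that by auto
    have "\<exists>!u. u \<in> pverts G \<and> ?d u \<noteq> ?e u"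
    proof (rule ex1I[of _ w])
      show "u = w" if "u \<in> pverts G \<and> ?d u \<noteq> ?e u" for u
        using only[of u] only[OF \<open>w \<in> pverts G\<close> w] that by blast
    qed (use w \<open>w \<in> pverts G\<close> in blast)
    then have "(?d, ?e) \<in> parcs (recoloring_graph k G)"
      using de unfolding recoloring_graph_def by auto
    then have "(?d, ?e) \<in> parcs (mk_symmetric (with_proj (recoloring_graph k G)))"
      by (force simp: parcs_mk_symmetric)
    moreover have "?e \<in> pverts (mk_symmetric (with_proj (recoloring_graph k G)))"
      using de by (simp add: recoloring_graph_def)
    ultimately show ?thesis
      using step.IH unfolding reachable_def by (auto intro: rtrancl_on_into_rtrancl_on)
  qed
qed

lemma recolorable_if_always_mixing:
  assumes G: "pair_graph G" and mix: "always_mixing (pverts G) (\<lambda>u v. (u, v) \<in> parcs G)"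
  shows "recolorable G"
  unfolding recolorable_def
proof (intro allI impI)
  interpret pair_graph G by fact
  let ?V = "pverts G" and ?E = "\<lambda>u v. (u, v) \<in> parcs G"
  fix l assume l: "chromatic_number G + 1 \<le> l"
  \<comment> \<open>Coloring all vertices differently shows that the minimum defining
    \<open>chromatic_number\<close> is attained.\<close>
  obtain f where f: "bij_betw f ?V {1..card ?V}"
    using pair_finite_verts by (metis bij_betw_iff_card card_atLeastAtMost diff_Suc_1 finite_atLeastAtMost)
  have "proper_col ?V ?E {1..card ?V} f"
    unfolding proper_col_def
  proof (intro conjI ballI impI)
    fix u v assume "u \<in> ?V" "v \<in> ?V" "(u, v) \<in> parcs G"
    then show "f u \<noteq> f v" using f pair_no_loops[of "(u, v)"] unfolding bij_betw_def by (auto dest: inj_onD)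
  qed (use f in \<open>auto simp: bij_betw_def\<close>)
  then have "restrict f ?V \<in> colorings G (card ?V)"
    unfolding colorings_iff[OF G] proper_col_restrict by auto
  then have "colorings G (chromatic_number G) \<noteq> {}"
    unfolding chromatic_number_def by (intro LeastI[of "\<lambda>k. colorings G k \<noteq> {}"]) auto
  then obtain g where g: "g \<in> colorings G (chromatic_number G)" by blast
  then have gp: "proper_col ?V ?E {1..chromatic_number G} g" unfolding colorings_iff[OF G] by auto
  then have col: "colorable ?V ?E (chromatic_number G)" by (rule colorable_card) auto
  \<comment> \<open>Connectedness in the library includes nonemptiness, so an
    \<open>l\<close>-coloring has to be exhibited.\<close>
  have "proper_col ?V ?E {1..l} g" by (rule proper_col_mono[OF gp]) (use l in auto)
  then have "g \<in> colorings G l" using g unfolding colorings_iff[OF G] by blast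
  then have ne: "colorings G l \<noteq> {}" by blast
  have "c \<rightarrow>\<^sup>*\<^bsub>with_proj (mk_symmetric (with_proj (recoloring_graph l G)))\<^esub> d"
    if "c \<in> colorings G l" "d \<in> colorings G l" for c d
  proof -
    have c: "proper_col ?V ?E {1..l} c" "restrict c ?V = c" and d: "proper_col ?V ?E {1..l} d" "restrict d ?V = d"
      using that unfolding colorings_iff[OF G] by (auto intro: extensional_restrict)
    have "linked ?V ?E {1..l} c d"
      by (rule always_mixingD[OF mix _ _ col c(1) d(1)]) (use l in auto)
    from linked_imp_reachable[OF G c(1) this] show ?thesis unfolding c(2) d(2) .
  qed
  then show "connected (with_proj (recoloring_graph l G))"
    unfolding connected_def strongly_connected_def
    using ne by (auto simp: recoloring_graph_def)
qed

section \<open>Induced copies of the forbidden graphs\<close>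

lemma induced_copy:
  fixes G :: "'a pair_pre_digraph" and F :: "nat pair_pre_digraph"
  assumes G: "pair_graph G" and len: "set xs \<subseteq> pverts G" "distinct xs"
    and F: "pverts F = {..<length xs}" "parcs F \<subseteq> {..<length xs} \<times> {..<length xs}"
    and adj: "\<And>i j. i < length xs \<Longrightarrow> j < length xs \<Longrightarrow> (i, j) \<in> parcs F \<longleftrightarrow> (xs ! i, xs ! j) \<in> parcs G"
  shows "\<exists>H. induced_subgraph H (with_proj G) \<and> digraph_iso H (with_proj F)"
proof -
  interpret pair_graph G by fact
  define A where "A = {(u, v). (u, v) \<in> parcs G \<and> u \<in> set xs \<and> v \<in> set xs}"
  let ?H = "with_proj \<lparr>pverts = set xs, parcs = A\<rparr>"
  \<comment> \<open>The isomorphism runs from the subgraph to \<open>F\<close>, hence it inverts the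
    enumeration \<open>xs\<close>.\<close>
  define g where "g = inv_into {..<length xs} ((!) xs)"
  have inj: "inj_on ((!) xs) {..<length xs}" using len(2) by (simp add: inj_on_nth)
  have img: "(!) xs ` {..<length xs} = set xs" by (auto simp: set_conv_nth)
  have g: "g (xs ! i) = i" if "i < length xs" for i
    unfolding g_def using inj that by (simp add: inv_into_f_f)
  have ginj: "inj_on g (set xs)" unfolding g_def img[symmetric] by (rule inj_on_inv_into) simp
  have gset: "g ` set xs = {..<length xs}" unfolding img[symmetric] image_image using g by auto
  have gA: "map_prod g g ` A = parcs F"
  proof
    show "map_prod g g ` A \<subseteq> parcs F"
      using adj g unfolding A_def by (auto simp: in_set_conv_nth)
    show "parcs F \<subseteq> map_prod g g ` A"
    proof
      fix p assume p: "p \<in> parcs F"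
      obtain i j where ij: "p = (i, j)" by (cases p)
      then have lt: "i < length xs" "j < length xs" using p F(2) by auto
      then have "(xs ! i, xs ! j) \<in> A" using adj p ij unfolding A_def by auto
      then have "map_prod g g (xs ! i, xs ! j) \<in> map_prod g g ` A" by (rule imageI)
      then show "p \<in> map_prod g g ` A" using g lt ij by simp
    qed
  qed
  have wfH: "wf_digraph ?H" by unfold_locales (auto simp: A_def)
  have wfG: "wf_digraph (with_proj G)" by unfold_locales
  have "induced_subgraph ?H (with_proj G)"
    unfolding induced_subgraph_def subgraph_def compatible_def
    using wfH wfG len(1) by (auto simp: A_def)
  moreover have "digraph_iso ?H (with_proj F)"
    unfolding digraph_iso_def
  proof (intro exI conjI)
    let ?f = "\<lparr>iso_verts = g, iso_arcs = map_prod g g, iso_head = snd, iso_tail = fst\<rparr>"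
    show "pre_digraph.digraph_isomorphism ?H ?f"
      unfolding pre_digraph.digraph_isomorphism_def
      using wfH ginj by (auto simp: A_def inj_on_def)
    show "with_proj F = app_iso ?f ?H"
      unfolding app_iso_def with_proj_def using gset gA F(1) by simp
  qed
  ultimately show ?thesis by blast
qed

lemma induced_copy5:
  fixes G :: "'a pair_pre_digraph" and F :: "nat pair_pre_digraph"
  assumes "pair_graph G" "set [a, b, c, d, e] \<subseteq> pverts G" "distinct [a, b, c, d, e]"
    and "pverts F = {..<5}" "parcs F \<subseteq> {..<5} \<times> {..<5}"
    and "\<forall>i\<in>{0,1,2,3,4}. \<forall>j\<in>{0,1,2,3,4}. (i, j) \<in> parcs F \<longleftrightarrow> ([a, b, c, d, e] ! i, [a, b, c, d, e] ! j) \<in> parcs G"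
  shows "\<exists>H. induced_subgraph H (with_proj G) \<and> digraph_iso H (with_proj F)"
proof (rule induced_copy[OF assms(1-3)])
  have len: "length [a, b, c, d, e] = 5" by simp
  show "pverts F = {..<length [a, b, c, d, e]}" unfolding len by (rule assms(4))
  show "parcs F \<subseteq> {..<length [a, b, c, d, e]} \<times> {..<length [a, b, c, d, e]}"
    unfolding len by (rule assms(5))
  fix i j assume "i < length [a, b, c, d, e]" "j < length [a, b, c, d, e]"
  then have "i \<in> {0,1,2,3,4}" "j \<in> {0,1,2,3,4}" by auto
  then show "(i, j) \<in> parcs F \<longleftrightarrow> ([a, b, c, d, e] ! i, [a, b, c, d, e] ! j) \<in> parcs G"
    using assms(6) by blast
qed

lemma induced_free_imp_pattern_free:
  fixes G :: "'a pair_pre_digraph"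
  assumes G: "pair_graph G" and free: "induced_free {P5, house, bull} G"
  defines "V \<equiv> pverts G" and "E \<equiv> \<lambda>u v. (u, v) \<in> parcs G"
  shows "p5_free V E" "house_free V E" "bull_free V E"
proof -
  interpret pair_graph G by fact
  have sym': "E x y \<longleftrightarrow> E y x" for x y using sym_arcs unfolding E_def symmetric_def by (auto dest: symD)
  have irr': "\<not> E x x" for x unfolding E_def using pair_no_loops[of "(x, x)"] by auto
  have no: "\<not> (\<exists>H. induced_subgraph H (with_proj G) \<and> digraph_iso H (with_proj F))"
    if "F \<in> {P5, house, bull}" for F
    using free that unfolding induced_free_def by blast
  show "p5_free V E"
    unfolding p5_free_def
  proof (intro ballI notI)
    fix a b c d e
    assume V: "a \<in> V" "b \<in> V" "c \<in> V" "d \<in> V" "e \<in> V"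
    assume pat: "E a b \<and> E b c \<and> E c d \<and> E d e \<and>
       \<not> E a c \<and> \<not> E a d \<and> \<not> E a e \<and> \<not> E b d \<and> \<not> E b e \<and> \<not> E c e"
    have "distinct [a, b, c, d, e]" using pat sym' irr' by (simp; metis)
    then have "\<exists>H. induced_subgraph H (with_proj G) \<and> digraph_iso H (with_proj P5)"
      using V pat sym' irr'
      by (intro induced_copy5[OF G, of a b c d e]) (auto simp: V_def E_def path_graph_def)
    then show False using no by blast
  qed
  show "house_free V E"
    unfolding house_free_def
  proof (intro ballI notI)
    fix a b c d e
    assume V: "a \<in> V" "b \<in> V" "c \<in> V" "d \<in> V" "e \<in> V"
    assume pat: "E a b \<and> E a c \<and> E b c \<and> E b d \<and> E c e \<and> E d e \<and>
       \<not> E a d \<and> \<not> E a e \<and> \<not> E b e \<and> \<not> E c d"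
    \<comment> \<open>The house is the complement of the path 0, 1, 2, 3, 4, so consecutive entries
      must be the non-edges: \<open>b e\<close>, \<open>e a\<close>, \<open>a d\<close>,
      \<open>d c\<close>.\<close>
    have "distinct [b, e, a, d, c]" using pat sym' irr' by (simp; metis)
    then have "\<exists>H. induced_subgraph H (with_proj G) \<and> digraph_iso H (with_proj house)"
      using V pat sym' irr'
      by (intro induced_copy5[OF G, of b e a d c])
        (auto simp: V_def E_def house_def complement_graph_def path_graph_def)
    then show False using no by blast
  qed
  show "bull_free V E"
    unfolding bull_free_def
  proof (intro ballI notI)
    fix a b c d e
    assume V: "a \<in> V" "b \<in> V" "c \<in> V" "d \<in> V" "e \<in> V"
    assume pat: "E a b \<and> E a c \<and> E b c \<and> E d a \<and> E e b \<and>
       \<not> E d b \<and> \<not> E d c \<and> \<not> E d e \<and> \<not> E e a \<and> \<not> E e c"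
    have "distinct [a, b, c, d, e]" using pat sym' irr' by (simp; metis)
    then have "\<exists>H. induced_subgraph H (with_proj G) \<and> digraph_iso H (with_proj bull)"
      using V pat sym' irr'
      by (intro induced_copy5[OF G, of a b c d e]) (auto simp: V_def E_def bull_def Let_def)
    then show False using no by blast
  qed
qed

theorem theorem5:
  fixes G :: "'a pair_pre_digraph"
  assumes "pair_graph G"
    and "induced_free {P5, house, bull} G"
  shows "recolorable G"
proof -
  interpret pair_graph G by fact
  have "symp (\<lambda>u v. (u, v) \<in> parcs G)"
    using sym_arcs unfolding symmetric_def by (auto intro: sympI dest: symD)
  moreover have "irreflp (\<lambda>u v. (u, v) \<in> parcs G)"
    by (rule irreflpI) (use pair_no_loops in fastforce)
  ultimately show ?thesis
    using induced_free_imp_pattern_free[OF assms] pair_finite_verts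
    by (intro recolorable_if_always_mixing assms(1) always_mixing_p5_house_bull_free)
qed

end
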